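(* Let $P,Q\in W^{(l)}$ and $(\rho,\sigma)\in\mathfrak V$ with $\sigma\le0$. Suppose $[Q,P]=1$, $v_{\rho,\sigma}(P)>0$, $v_{\rho,\sigma}(Q)>0$, $[P,Q]_{\rho,\sigma}=0$, $v_{\rho,\sigma}(P)/v_{\rho,\sigma}(Q)\notin\mathbb{N}$ and $v_{\rho,\sigma}(Q)/v_{\rho,\sigma}(P)\notin\mathbb{N}$. Then: (1) If $(\rho,\sigma)\notin\mathrm{Val}(P)$, then $v_{1,-1}(\ell_{\rho,\sigma}(P))\ne0$. (2) $v_{1,-1}(\mathrm{st}_{\rho,\sigma}(P))\neq0$. (3) There exists a $(\rho,\sigma)$-homogeneous $F\in W^{(l)}$ with $[P,F]_{\rho,\sigma}=\ell_{\rho,\sigma}(P)$ and $[Q,F]_{\rho,\sigma}=\frac{v_{\rho,\sigma}(Q)}{v_{\rho,\sigma}(P)}\ell_{\rho,\sigma}(Q)$; moreover $v_{\rho,\sigma}(F)=\rho+\sigma$ and $f^{(l)}_{[P,F],\rho,\sigma}=f^{(l)}_{P,\rho,\sigma}$.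
   Context: $K$ is a field of characteristic zero, $l\in\mathbb{N}$. $W^{(l)}$ is the associative $K$-algebra with $K$-basis $\{X^{i/l}Y^j:i\in\mathbb{Z},j\in\mathbb{N}_0\}$, powers of $X$ multiplying as Laurent monomials and $[Y,X^{\alpha}]=\alpha X^{\alpha-1}$ for $\alpha\in\frac1l\mathbb{Z}$. $L^{(l)}=K[x^{1/l},x^{-1/l},y]$, $\Psi^{(l)}(X^{i/l}Y^j)=x^{i/l}y^j$ ($K$-linear); $\mathrm{Supp}$ = exponents with nonzero coefficient (for $P\in W^{(l)}$, of $\Psi^{(l)}(P)$). $\mathfrak V=\{(\rho,\sigma)\in\mathbb{Z}^2:\gcd(\rho,\sigma)=1,\rho+\sigma>0\}$; $v_{\rho,\sigma}(a,b)=\rho a+\sigma b$. For $P\ne0$: $v_{\rho,\sigma}(P)=\max$ of $v_{\rho,\sigma}$ over $\mathrm{Supp}(P)$ (this also defines $v_{1,-1}$ of a nonzero element of $L^{(l)}$); $\ell_{\rho,\sigma}(P)$ is the sum of the terms of $\Psi^{(l)}(P)$ of $(\rho,\sigma)$-degree $v_{\rho,\sigma}(P)$; $(\rho,\sigma)$-homogeneous means equal to its leading term (or $0$). $\mathrm{st}_{\rho,\sigma}(P)$ is, among the points $(a,b)\in\mathrm{Supp}(\ell_{\rho,\sigma}(P))$ maximizing $a-b$, the one with largest $a$. $\mathrm{Val}(P)=\{(\rho,\sigma)\in\mathfrak V:\#\mathrm{Supp}(\ell_{\rho,\sigma}(P))>1\}$. $[P,Q]_{\rho,\sigma}:=0$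 if $[P,Q]=0$ or $v_{\rho,\sigma}([P,Q])<v_{\rho,\sigma}(P)+v_{\rho,\sigma}(Q)-(\rho+\sigma)$, and $:=\ell_{\rho,\sigma}([P,Q])$ otherwise. For $\sigma\le0$ and $P\ne0$, write $\ell_{\rho,\sigma}(P)=\sum_{i=0}^\gamma a_ix^{\frac rl-\frac{i\sigma}\rho}y^{s+i}$ with $a_0\ne0\ne a_\gamma$ and set $f^{(l)}_{P,\rho,\sigma}=\sum_{i=0}^\gamma a_ix^i$. *)

theory Defs
  imports Main "HOL-Computational_Algebra.Polynomial"
begin

text \<open>An element of W^(l) (and of L^(l)) is represented by its coefficient function
  on index pairs (i,j), standing for X^(i/l) Y^j (resp. x^(i/l) y^j); elements must have
  finite support.\<close>

type_synonym 'a wel = "int \<times> nat \<Rightarrow> 'a"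

definition wsupp :: "'a::zero wel \<Rightarrow> (int \<times> nat) set" where
  "wsupp P = {p. P p \<noteq> 0}"

definition wfin :: "'a::zero wel \<Rightarrow> bool" where
  "wfin P \<longleftrightarrow> finite (wsupp P)"

definition falling :: "'a::field_char_0 \<Rightarrow> nat \<Rightarrow> 'a" where
  "falling b k = (\<Prod>t<k. b - of_nat t)"

text \<open>Product in W^(l):  X^a Y^j * X^b Y^m = sum_k C(j,k) (b)_k X^(a+b-k) Y^(j+m-k),
  coming from [Y, X^b] = b X^(b-1).\<close>
definition wmul :: "nat \<Rightarrow> 'a::field_char_0 wel \<Rightarrow> 'a wel \<Rightarrow> 'a wel" where
  "wmul l P Q = (\<lambda>(c, d). \<Sum>(a, j)\<in>wsupp P. \<Sum>(b, m)\<in>wsupp Q. \<Sum>k\<in>{0..j}.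
     if a + b - int k * int l = c \<and> j + m - k = d
     then P (a, j) * Q (b, m) * of_nat (j choose k) * falling (of_int b / of_nat l) k
     else 0)"

definition wcomm :: "nat \<Rightarrow> 'a::field_char_0 wel \<Rightarrow> 'a wel \<Rightarrow> 'a wel" where
  "wcomm l P Q = (\<lambda>p. wmul l P Q p - wmul l Q P p)"

definition wone :: "'a::field_char_0 wel" where
  "wone = (\<lambda>p. if p = (0, 0) then 1 else 0)"

definition vdeg :: "nat \<Rightarrow> int \<Rightarrow> int \<Rightarrow> int \<times> nat \<Rightarrow> rat" where
  "vdeg l \<rho> \<sigma> p = of_int \<rho> * (of_int (fst p) / of_nat l) + of_int \<sigma> * of_nat (snd p)"

definition vval :: "nat \<Rightarrow> int \<Rightarrow> int \<Rightarrow> 'a::zero wel \<Rightarrow> rat" where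
  "vval l \<rho> \<sigma> P = Max (vdeg l \<rho> \<sigma> ` wsupp P)"

definition lead :: "nat \<Rightarrow> int \<Rightarrow> int \<Rightarrow> 'a::zero wel \<Rightarrow> 'a wel" where
  "lead l \<rho> \<sigma> P = (\<lambda>p. if vdeg l \<rho> \<sigma> p = vval l \<rho> \<sigma> P then P p else 0)"

definition homog :: "nat \<Rightarrow> int \<Rightarrow> int \<Rightarrow> 'a::zero wel \<Rightarrow> bool" where
  "homog l \<rho> \<sigma> P \<longleftrightarrow> P = (\<lambda>_. 0) \<or> lead l \<rho> \<sigma> P = P"

definition bracket :: "nat \<Rightarrow> int \<Rightarrow> int \<Rightarrow> 'a::field_char_0 wel \<Rightarrow> 'a wel \<Rightarrow> 'a wel" where
  "bracket l \<rho> \<sigma> P Q =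
    (if wcomm l P Q = (\<lambda>_. 0) \<or>
        vval l \<rho> \<sigma> (wcomm l P Q) < vval l \<rho> \<sigma> P + vval l \<rho> \<sigma> Q - of_int (\<rho> + \<sigma>)
     then (\<lambda>_. 0) else lead l \<rho> \<sigma> (wcomm l P Q))"

definition Vset :: "(int \<times> int) set" where
  "Vset = {(\<rho>, \<sigma>). gcd \<rho> \<sigma> = 1 \<and> \<rho> + \<sigma> > 0}"

definition Val :: "nat \<Rightarrow> 'a::zero wel \<Rightarrow> (int \<times> int) set" where
  "Val l P = {(\<rho>, \<sigma>) \<in> Vset. card (wsupp (lead l \<rho> \<sigma> P)) > 1}"

definition st :: "nat \<Rightarrow> int \<Rightarrow> int \<Rightarrow> 'a::zero wel \<Rightarrow> int \<times> nat" where
  "st l \<rho> \<sigma> P = (let S = wsupp (lead l \<rho> \<sigma> P) in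
     THE p. p \<in> S \<and> (\<forall>q\<in>S. vdeg l 1 (-1) q \<le> vdeg l 1 (-1) p) \<and>
            (\<forall>q\<in>S. vdeg l 1 (-1) q = vdeg l 1 (-1) p \<longrightarrow> fst q \<le> fst p))"

text \<open>f^(l)_{P,rho,sigma} = sum_i a_i x^i where l_{rho,sigma}(P) = sum_i a_i x^(r/l - i sigma/rho) y^(s+i).\<close>
definition fpoly :: "nat \<Rightarrow> int \<Rightarrow> int \<Rightarrow> 'a::comm_ring_1 wel \<Rightarrow> 'a poly" where
  "fpoly l \<rho> \<sigma> P = (let L = lead l \<rho> \<sigma> P; s = Min (snd ` wsupp L);
      \<gamma> = Max (snd ` wsupp L) - s in
     (\<Sum>i\<le>\<gamma>. monom (\<Sum>p\<in>{p \<in> wsupp L. snd p = s + i}. L p) i))"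

end

theory Submission
  imports Defs
    "HOL-Library.Function_Algebras"
    "HOL-Computational_Algebra.Formal_Power_Series"
    "HOL-Computational_Algebra.Polynomial_Factorial"
begin

text \<open>Leading terms turn the commutator into a Poisson bracket. Setting x = 1, a homogeneous element
  of weight u becomes a polynomial p in y, and the bracket of p with an element g of weight v becomes
  v p' g - u p g' up to a constant.

  The monomials in P and Q span a space of quadratic growth. If every G in the algebra generated by P and Q
  had a leading term commuting with that of P, then the leading exponents would lie on a line. Since ad P
  and ad Q reduce every G to a nonzero constant in boundedly many steps, the weights are bounded below
  linearly, so there would be too few leading exponents. Hence some G has a nonzero bracket with
  P at the level of leading terms, and by nilpotency of ad P one may also assume that e = {p, g} is nonzero
  and commutes with p. Then F = g p / e satisfies {p, F} = p; comparing the multiplicities of prime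
  factors shows that F is a polynomial. Finally, if the starting point of P were (b, b), the
  two lowest coefficients of {p, F} = p would contradict each other.\<close>

section \<open>The algebra W\<close>

text \<open>The leading terms p and q commute, hence so does every product of them with p; a
  suitable g can only come from cancellation of leading terms in a combination of the P^i Q^j. It is
  found by counting. If {p, g} = 0 with g of weight v, then the order of g at y = 0 is v/u times
  that of p, and the lowest exponent of g is v/u times the one of p. So each weight v has a single
  point to avoid. Combinations with i, j at most N have (N+1)^2 free coefficients and weights
  between -B and B, where B = N (u + w). Removing the coefficients at the 2B + 1 points leaves a
  nontrivial combination once N = 2 (u + w), because then 2B = N^2. The formula for F comes from the
  derivation property: {p, p} = 0 and {p, e} = 0 give {p, g p / e} = ({p, g} / e) p = p. Since K
  need not be algebraically closed, prime polynomials replace roots in the study of the poles of g p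
  / e.\<close>

lemma falling_gchoose: "falling b k = fact k * (b gchoose k)"
  by (simp add: falling_def gbinomial_prod_rev lessThan_atLeast0)

lemma falling_add: "falling b (j + k) = falling b j * falling (b - of_nat j) k"
  by (induction k) (simp_all add: falling_def algebra_simps)

text \<open>This is the Leibniz rule for the j-th derivative of x^b x^a with the powers of x
  removed; it makes \<open>act\<close> compatible with products.\<close>

lemma falling_Vandermonde:
  "falling (a + b) j = (\<Sum>k\<le>j. of_nat (j choose k) * falling b k * falling a (j - k))"
proof -
  have "falling (a + b) j = fact j * (\<Sum>k\<le>j. (b gchoose k) * (a gchoose (j - k)))"
    by (simp add: falling_gchoose gbinomial_Vandermonde atMost_atLeast0 add.commute)
  also have "\<dots> = (\<Sum>k\<le>j. of_nat (j choose k) * falling b k * falling a (j - k))"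
    unfolding sum_distrib_left
    by (rule sum.cong) (auto simp: falling_gchoose binomial_fact field_simps)
  finally show ?thesis .
qed

lemma falling_of_nat_eq_0: "t < j \<Longrightarrow> falling (of_nat t) j = 0"
  by (auto simp: falling_def)

lemma falling_of_nat_self: "falling (of_nat t) t = fact t"
  by (simp add: falling_gchoose gbinomial_of_nat_symmetric binomial_gbinomial[symmetric])

section \<open>The product formula and associativity\<close>

definition mulcoeff :: "nat \<Rightarrow> int \<times> nat \<Rightarrow> int \<times> nat \<Rightarrow> nat \<Rightarrow> 'a::field_char_0" where
  "mulcoeff l p q k = of_nat (snd p choose k) * falling (of_int (fst q) / of_nat l) k"

text \<open>Term k of a product of monomials arises when k of the Y in \<open>p\<close>
  differentiate the power of X in \<open>q\<close>. The truncated subtraction is exact for k up to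
  \<open>snd p\<close>, the only range in use.\<close>

definition mulpos :: "nat \<Rightarrow> int \<times> nat \<Rightarrow> int \<times> nat \<Rightarrow> nat \<Rightarrow> int \<times> nat" where
  "mulpos l p q k = (fst p + fst q - int k * int l, snd p + snd q - k)"

lemma wmul_eq:
  assumes "finite A" "finite B" "wsupp P \<subseteq> A" "wsupp Q \<subseteq> B"
  shows "wmul l P Q x = (\<Sum>p\<in>A. \<Sum>q\<in>B. P p * Q q *
           (\<Sum>k\<le>snd p. if mulpos l p q k = x then mulcoeff l p q k else 0))"
proof -
  have "wmul l P Q x = (\<Sum>p\<in>wsupp P. \<Sum>q\<in>wsupp Q. P p * Q q *
           (\<Sum>k\<le>snd p. if mulpos l p q k = x then mulcoeff l p q k else 0))"
    unfolding wmul_def sum_distrib_left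
    by (cases x) (auto simp: mulcoeff_def mulpos_def case_prod_unfold atMost_atLeast0 intro!: sum.cong)
  also have "\<dots> = (\<Sum>p\<in>A. \<Sum>q\<in>wsupp Q. P p * Q q *
           (\<Sum>k\<le>snd p. if mulpos l p q k = x then mulcoeff l p q k else 0))"
    by (rule sum.mono_neutral_left) (use assms in \<open>auto simp: wsupp_def\<close>)
  also have "\<dots> = (\<Sum>p\<in>A. \<Sum>q\<in>B. P p * Q q *
           (\<Sum>k\<le>snd p. if mulpos l p q k = x then mulcoeff l p q k else 0))"
    by (intro sum.cong refl sum.mono_neutral_left) (use assms in \<open>auto simp: wsupp_def\<close>)
  finally show ?thesis .
qed

lemma wsupp_wmul_subset:
  assumes "wfin P" "wfin Q"
  shows "wsupp (wmul l P Q) \<subseteq> (\<Union>p\<in>wsupp P. \<Union>q\<in>wsupp Q. mulpos l p q ` {..snd p})"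
proof
  fix x assume "x \<in> wsupp (wmul l P Q)"
  then have "wmul l P Q x \<noteq> 0" by (simp add: wsupp_def)
  then have "(\<Sum>p\<in>wsupp P. \<Sum>q\<in>wsupp Q. P p * Q q *
           (\<Sum>k\<le>snd p. if mulpos l p q k = x then mulcoeff l p q k else 0)) \<noteq> 0"
    using wmul_eq[of "wsupp P" "wsupp Q" P Q l x] assms by (simp add: wfin_def)
  then obtain p where p: "p \<in> wsupp P" and p2: "(\<Sum>q\<in>wsupp Q. P p * Q q *
           (\<Sum>k\<le>snd p. if mulpos l p q k = x then mulcoeff l p q k else 0)) \<noteq> 0"
    by (rule sum.not_neutral_contains_not_neutral)
  from p2 obtain q where q: "q \<in> wsupp Q" and q2: "P p * Q q *
           (\<Sum>k\<le>snd p. if mulpos l p q k = x then mulcoeff l p q k else 0) \<noteq> 0"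
    by (rule sum.not_neutral_contains_not_neutral)
  from q2 have "(\<Sum>k\<le>snd p. if mulpos l p q k = x then mulcoeff l p q k else (0::'a)) \<noteq> 0"
    using mult_not_zero by blast
  then obtain k where "k \<in> {..snd p}" "(if mulpos l p q k = x then mulcoeff l p q k else (0::'a)) \<noteq> 0"
    by (rule sum.not_neutral_contains_not_neutral)
  then show "x \<in> (\<Union>p\<in>wsupp P. \<Union>q\<in>wsupp Q. mulpos l p q ` {..snd p})"
    using p q by (intro UN_I) (auto split: if_splits)
qed

lemma wfin_wmul: "wfin P \<Longrightarrow> wfin Q \<Longrightarrow> wfin (wmul l P Q)"
  unfolding wfin_def
  by (rule finite_subset[OF wsupp_wmul_subset]) (auto simp: wfin_def)

text \<open>The free test function \<open>h\<close> lets one computation serve twice: for operators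
  in \<open>act_wmul\<close> and for homogeneous parts in \<open>hat_wmul\<close>.\<close>

lemma sum_wmul:
  assumes "wfin P" "wfin Q" "finite U" "wsupp (wmul l P Q) \<subseteq> U"
  shows "(\<Sum>x\<in>U. wmul l P Q x * h x) = (\<Sum>p\<in>wsupp P. \<Sum>q\<in>wsupp Q. P p * Q q *
           (\<Sum>k\<le>snd p. mulcoeff l p q k * h (mulpos l p q k)))"
proof -
  let ?U = "(\<Union>p\<in>wsupp P. \<Union>q\<in>wsupp Q. mulpos l p q ` {..snd p})"
  have fU: "finite ?U" using assms by (auto simp: wfin_def)
  have "(\<Sum>x\<in>U. wmul l P Q x * h x) = (\<Sum>x\<in>wsupp (wmul l P Q). wmul l P Q x * h x)"
    by (rule sum.mono_neutral_right) (use assms in \<open>auto simp: wsupp_def\<close>)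
  also have "\<dots> = (\<Sum>x\<in>?U. wmul l P Q x * h x)"
    by (rule sum.mono_neutral_left[OF fU wsupp_wmul_subset]) (use assms in \<open>auto simp: wsupp_def\<close>)
  also have "\<dots> = (\<Sum>x\<in>?U. \<Sum>p\<in>wsupp P. \<Sum>q\<in>wsupp Q. \<Sum>k\<le>snd p.
      (if mulpos l p q k = x then P p * Q q * mulcoeff l p q k * h x else 0))"
    unfolding wmul_eq[OF assms(1,2)[unfolded wfin_def] order.refl order.refl] sum_distrib_right sum_distrib_left
    by (intro sum.cong refl) simp
  also have "\<dots> = (\<Sum>p\<in>wsupp P. \<Sum>q\<in>wsupp Q. \<Sum>k\<le>snd p. \<Sum>x\<in>?U.
      (if mulpos l p q k = x then P p * Q q * mulcoeff l p q k * h x else 0))"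
    by (rule trans[OF sum.swap], rule sum.cong[OF refl], rule trans[OF sum.swap],
        rule sum.cong[OF refl], rule sum.swap)
  also have "\<dots> = (\<Sum>p\<in>wsupp P. \<Sum>q\<in>wsupp Q. \<Sum>k\<le>snd p. P p * Q q * mulcoeff l p q k * h (mulpos l p q k))"
  proof (intro sum.cong refl, goal_cases)
    case (1 p q k)
    then have "mulpos l p q k \<in> ?U" by blast
    then show ?case by (subst sum.delta'[OF fU]) (simp only: if_True)
  qed
  finally show ?thesis by (simp add: sum_distrib_left mult.assoc)
qed

text \<open>W^(l) acts faithfully on formal Laurent sums in x^(1/l), with Y acting as d/dx;
  associativity of the product is inherited from the composition of operators.\<close>

definition act :: "nat \<Rightarrow> 'a::field_char_0 wel \<Rightarrow> (int \<Rightarrow> 'a) \<Rightarrow> int \<Rightarrow> 'a" where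
  "act l P f n = (\<Sum>p\<in>wsupp P. P p *
     (falling (of_int (n - fst p + int l * int (snd p)) / of_nat l) (snd p)
        * f (n - fst p + int l * int (snd p))))"

lemma act_wmul:
  assumes l: "l \<ge> 1" and P: "wfin P" and Q: "wfin Q"
  shows "act l (wmul l P Q) f = act l P (act l Q f)"
proof
  fix n
  let ?F = "\<lambda>n p. falling (of_int (n - fst p + int l * int (snd p)) / of_nat l) (snd p)
        * f (n - fst p + int l * int (snd p))"
  \<comment> \<open>A monomial with exponents (a, j) maps x^(m/l) to a multiple of x^((m+a)/l - j).
    Hence a single coefficient of \<open>f\<close>, the one with index \<open>N\<close> below,
    reaches degree n, and the identity is about its factors only.\<close>
  have key: "(\<Sum>k\<le>snd p. mulcoeff l p q k * ?F n (mulpos l p q k)) =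
     falling (of_int (n - fst p + int l * int (snd p)) / of_nat l) (snd p) *
       ?F (n - fst p + int l * int (snd p)) q" for p q
  proof -
    obtain a j b m where pq: "p = (a, j)" "q = (b, m)" by (metis surj_pair)
    define N where "N = n - a + int l * int j - b + int l * int m"
    define z :: 'a where "z = of_int N / of_nat l"
    have F: "?F n (mulpos l p q k) = falling z (m + (j - k)) * f N" if "k \<le> j" for k
    proof -
      have "n - (a + b - int k * int l) + int l * int (j + m - k) = N"
        using that by (simp add: N_def algebra_simps of_nat_diff)
      then show ?thesis using that
        by (simp add: pq mulpos_def z_def add.commute del: of_int_add of_int_diff of_int_mult of_nat_diff)
    qed
    have "(\<Sum>k\<le>snd p. mulcoeff l p q k * ?F n (mulpos l p q k)) =
       (\<Sum>k\<le>j. of_nat (j choose k) * falling (of_int b / of_nat l) k * falling (z - of_nat m) (j - k)) * (falling z m * f N)"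
      unfolding sum_distrib_right
    proof (rule sum.cong, goal_cases)
      case (2 k)
      then show ?case using F[of k] by (simp add: pq mulcoeff_def falling_add del: add_diff_assoc)
    qed (simp add: pq)
    also have "\<dots> = falling (z - of_nat m + of_int b / of_nat l) j * (falling z m * f N)"
      by (simp only: falling_Vandermonde)
    also have "z - of_nat m + of_int b / of_nat l = of_int (n - a + int l * int j) / of_nat l"
      using l by (simp add: z_def N_def field_simps)
    finally show ?thesis by (simp add: pq z_def N_def)
  qed
  have "act l (wmul l P Q) f n = (\<Sum>p\<in>wsupp P. \<Sum>q\<in>wsupp Q. P p * Q q *
           (\<Sum>k\<le>snd p. mulcoeff l p q k * ?F n (mulpos l p q k)))"
    unfolding act_def
    by (rule sum_wmul[OF P Q]) (use wfin_wmul[OF P Q] in \<open>auto simp: wfin_def\<close>)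
  also have "\<dots> = act l P (act l Q f) n"
    unfolding act_def key sum_distrib_left by (intro sum.cong refl) (simp only: mult_ac)
  finally show "act l (wmul l P Q) f n = act l P (act l Q f) n" .
qed

lemma act_superset:
  assumes "finite U" "wsupp P \<subseteq> U"
  shows "act l P f n = (\<Sum>p\<in>U. P p *
     (falling (of_int (n - fst p + int l * int (snd p)) / of_nat l) (snd p)
        * f (n - fst p + int l * int (snd p))))"
  unfolding act_def by (rule sum.mono_neutral_left) (use assms in \<open>auto simp: wsupp_def\<close>)

text \<open>Y^j kills x^t for j > t and turns it into the constant t! for j = t. Acting on x^t
  therefore determines the coefficient with Y-exponent t from those with smaller exponent,
  separately on each line i - l j = e.\<close>

lemma act_inj:
  assumes l: "l \<ge> 1" and P: "wfin P" and Q: "wfin Q"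
    and eq: "\<And>f. act l P f = act l Q f"
  shows "P = Q"
proof -
  define U where "U = wsupp P \<union> wsupp Q"
  have fU: "finite U" using P Q by (simp add: U_def wfin_def)
  have "P (e + int l * int t, t) = Q (e + int l * int t, t)" for e t
  proof (induction t rule: less_induct)
    case (less t)
    define x where "x = (e + int l * int t, t)"
    define f where "f = (\<lambda>m::int. if m = int l * int t then 1 else 0 :: 'a)"
    define n where "n = e + int l * int t"
    define T where "T = (\<lambda>R::'a wel. \<lambda>p. R p * (falling (of_int (n - fst p + int l * int (snd p)) / of_nat l) (snd p)
        * f (n - fst p + int l * int (snd p))))"
    have "(\<Sum>p\<in>U. T P p) = (\<Sum>p\<in>U. T Q p)"
      using eq[of f] act_superset[OF fU, of P l f n] act_superset[OF fU, of Q l f n]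
      by (simp add: T_def U_def)
    moreover have T0: "T P p = T Q p" if "p \<noteq> x" for p
    proof (cases "n - fst p + int l * int (snd p) = int l * int t \<and> snd p \<le> t")
      case True
      then have "fst p = e + int l * int (snd p)" by (simp add: n_def)
      moreover have "snd p \<noteq> t" using that calculation by (cases p) (auto simp: x_def)
      ultimately have "P p = Q p" using less.IH[of "snd p"] True by (cases p) auto
      then show ?thesis by (simp add: T_def)
    next
      case False
      have "falling (of_nat t :: 'a) (snd p) = 0" if "\<not> snd p \<le> t"
        using that by (intro falling_of_nat_eq_0) simp
      moreover have "of_int (int l * int t) / of_nat l = (of_nat t :: 'a)" using l by simp
      ultimately show ?thesis using False by (auto simp del: of_int_add of_int_diff of_int_mult simp: T_def f_def)
    qed
    moreover have "(\<Sum>p\<in>U - {x}. T P p) = (\<Sum>p\<in>U - {x}. T Q p)"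
      by (rule sum.cong) (use T0 in auto)
    ultimately have "x \<in> U \<Longrightarrow> T P x = T Q x"
      using sum.remove[OF fU, of x "T P"] sum.remove[OF fU, of x "T Q"] by simp
    moreover have "T R x = R x * fact t" for R
      using l by (simp add: T_def x_def n_def f_def falling_of_nat_self)
    ultimately have "x \<in> U \<Longrightarrow> P x = Q x" by auto
    moreover have "x \<notin> U \<Longrightarrow> P x = Q x" by (auto simp: U_def wsupp_def)
    ultimately show ?case by (auto simp: x_def)
  qed
  from this[of "i - int l * int j" j for i j] show ?thesis by (auto simp: fun_eq_iff)
qed

lemma wmul_assoc:
  assumes "l \<ge> 1" "wfin P" "wfin Q" "wfin R"
  shows "wmul l (wmul l P Q) R = wmul l P (wmul l Q R)"
  by (rule act_inj[OF assms(1)]) (simp_all add: assms wfin_wmul act_wmul[OF assms(1)])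

section \<open>Bilinearity, and the commutator as a derivation\<close>

lemma wfin_diff: "wfin P \<Longrightarrow> wfin Q \<Longrightarrow> wfin (P - Q :: 'a::ab_group_add wel)"
  unfolding wfin_def by (rule finite_subset[of _ "wsupp P \<union> wsupp Q"]) (auto simp: wsupp_def)

lemma wmul_diff_left:
  assumes "wfin P" "wfin P'" "wfin Q"
  shows "wmul l (P - P') Q = wmul l P Q - wmul l P' Q"
proof
  fix x
  let ?U = "wsupp P \<union> wsupp P'"
  have "finite ?U" "finite (wsupp Q)" "wsupp (P - P') \<subseteq> ?U"
    using assms by (auto simp: wfin_def wsupp_def)
  then show "wmul l (P - P') Q x = (wmul l P Q - wmul l P' Q) x"
    by (simp add: wmul_eq[of ?U "wsupp Q"] sum_subtractf[symmetric] left_diff_distrib)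
qed

lemma wmul_diff_right:
  assumes "wfin P" "wfin P'" "wfin Q"
  shows "wmul l Q (P - P') = wmul l Q P - wmul l Q P'"
proof
  fix x
  let ?U = "wsupp P \<union> wsupp P'"
  have "finite ?U" "finite (wsupp Q)" "wsupp (P - P') \<subseteq> ?U"
    using assms by (auto simp: wfin_def wsupp_def)
  then show "wmul l Q (P - P') x = (wmul l Q P - wmul l Q P') x"
    by (simp add: wmul_eq[of "wsupp Q" ?U] sum_subtractf[symmetric] left_diff_distrib right_diff_distrib)
qed

lemma wcomm_eq_diff: "wcomm l P Q = wmul l P Q - wmul l Q P"
  by (simp add: wcomm_def fun_diff_def)

lemma wfin_wcomm: "wfin P \<Longrightarrow> wfin Q \<Longrightarrow> wfin (wcomm l P Q)"
  by (simp add: wcomm_eq_diff wfin_diff wfin_wmul)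

lemma wcomm_Leibniz:
  assumes "l \<ge> 1" "wfin P" "wfin A" "wfin B"
  shows "wcomm l P (wmul l A B) = wmul l (wcomm l P A) B + wmul l A (wcomm l P B)"
  unfolding wcomm_eq_diff
  by (simp add: assms wmul_diff_left wmul_diff_right wfin_wmul wmul_assoc[OF assms(1)])

lemma wfin_wone: "wfin wone"
proof -
  have "wsupp (wone :: 'a wel) = {(0, 0)}" by (auto simp: wsupp_def wone_def)
  then show ?thesis by (simp add: wfin_def)
qed

lemma act_wone: "act l wone f = f"
proof
  fix n
  have "wsupp (wone :: 'a wel) = {(0, 0)}" by (auto simp: wsupp_def wone_def)
  then show "act l wone f n = f n" by (simp add: act_def wone_def falling_def)
qed

lemma wmul_wone_left:
  assumes "l \<ge> 1" "wfin P"
  shows "wmul l wone P = P"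
  by (rule act_inj[OF assms(1)]) (simp_all add: assms wfin_wmul wfin_wone act_wmul[OF assms(1)] act_wone)

lemma wmul_wone_right:
  assumes "l \<ge> 1" "wfin P"
  shows "wmul l P wone = P"
  by (rule act_inj[OF assms(1)]) (simp_all add: assms wfin_wmul wfin_wone act_wmul[OF assms(1)] act_wone)

lemma wfin_sum:
  fixes c :: "'i \<Rightarrow> 'a::field_char_0"
  assumes "finite I" "\<And>i. i \<in> I \<Longrightarrow> wfin (G i)"
  shows "wfin (\<lambda>x. \<Sum>i\<in>I. c i * G i x)"
proof -
  have "wsupp (\<lambda>x. \<Sum>i\<in>I. c i * G i x) \<subseteq> (\<Union>i\<in>I. wsupp (G i))"
  proof
    fix x assume "x \<in> wsupp (\<lambda>x. \<Sum>i\<in>I. c i * G i x)"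
    then have "(\<Sum>i\<in>I. c i * G i x) \<noteq> 0" by (simp add: wsupp_def)
    then obtain i where "i \<in> I" "c i * G i x \<noteq> 0" by (rule sum.not_neutral_contains_not_neutral)
    then show "x \<in> (\<Union>i\<in>I. wsupp (G i))" by (auto simp: wsupp_def)
  qed
  then show ?thesis using assms by (auto simp: wfin_def intro: finite_subset)
qed

lemma wmul_sum:
  fixes c :: "'i \<Rightarrow> 'a::field_char_0"
  assumes "finite I" "wfin P" "\<And>i. i \<in> I \<Longrightarrow> wfin (G i)"
  shows "wmul l P (\<lambda>x. \<Sum>i\<in>I. c i * G i x) = (\<lambda>x. \<Sum>i\<in>I. c i * wmul l P (G i) x)"
    and "wmul l (\<lambda>x. \<Sum>i\<in>I. c i * G i x) P = (\<lambda>x. \<Sum>i\<in>I. c i * wmul l (G i) P x)"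
proof -
  define S where "S = (\<lambda>x. \<Sum>i\<in>I. c i * G i x)"
  define U where "U = wsupp S \<union> (\<Union>i\<in>I. wsupp (G i))"
  have U: "finite U" "wsupp S \<subseteq> U" "\<And>i. i \<in> I \<Longrightarrow> wsupp (G i) \<subseteq> U" and P: "finite (wsupp P)"
    using assms wfin_sum[where I = I and G = G and c = c] by (auto simp: U_def S_def wfin_def)
  show "wmul l P S = (\<lambda>x. \<Sum>i\<in>I. c i * wmul l P (G i) x)"
  proof
    fix x
    define K where "K p q = (\<Sum>k\<le>snd p. if mulpos l p q k = x then mulcoeff l p q k else (0::'a))" for p q
    have "wmul l P S x = (\<Sum>p\<in>wsupp P. \<Sum>q\<in>U. \<Sum>i\<in>I. P p * (c i * G i q) * K p q)"
      unfolding wmul_eq[OF P U(1) order.refl U(2)] K_def[symmetric]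
      by (simp add: S_def sum_distrib_left sum_distrib_right)
    also have "\<dots> = (\<Sum>p\<in>wsupp P. \<Sum>i\<in>I. \<Sum>q\<in>U. P p * (c i * G i q) * K p q)"
      by (rule sum.cong[OF refl], rule sum.swap)
    also have "\<dots> = (\<Sum>i\<in>I. \<Sum>p\<in>wsupp P. \<Sum>q\<in>U. P p * (c i * G i q) * K p q)"
      by (rule sum.swap)
    also have "\<dots> = (\<Sum>i\<in>I. c i * wmul l P (G i) x)"
      by (rule sum.cong[OF refl], subst wmul_eq[OF P U(1) order.refl U(3)])
        (simp_all add: K_def[symmetric] sum_distrib_left mult_ac)
    finally show "wmul l P S x = (\<Sum>i\<in>I. c i * wmul l P (G i) x)" .
  qed
  show "wmul l S P = (\<lambda>x. \<Sum>i\<in>I. c i * wmul l (G i) P x)"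
  proof
    fix x
    define K where "K p q = (\<Sum>k\<le>snd p. if mulpos l p q k = x then mulcoeff l p q k else (0::'a))" for p q
    have "wmul l S P x = (\<Sum>q\<in>U. \<Sum>p\<in>wsupp P. \<Sum>i\<in>I. (c i * G i q) * P p * K q p)"
      unfolding wmul_eq[OF U(1) P U(2) order.refl] K_def[symmetric]
      by (simp add: S_def sum_distrib_left sum_distrib_right)
    also have "\<dots> = (\<Sum>q\<in>U. \<Sum>i\<in>I. \<Sum>p\<in>wsupp P. (c i * G i q) * P p * K q p)"
      by (rule sum.cong[OF refl], rule sum.swap)
    also have "\<dots> = (\<Sum>i\<in>I. \<Sum>q\<in>U. \<Sum>p\<in>wsupp P. (c i * G i q) * P p * K q p)"
      by (rule sum.swap)
    also have "\<dots> = (\<Sum>i\<in>I. c i * wmul l (G i) P x)"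
      by (rule sum.cong[OF refl], subst wmul_eq[OF U(1) P U(3) order.refl])
        (simp_all add: K_def[symmetric] sum_distrib_left mult_ac)
    finally show "wmul l S P x = (\<Sum>i\<in>I. c i * wmul l (G i) P x)" .
  qed
qed

lemma wcomm_sum:
  assumes "finite I" "wfin P" "\<And>i. i \<in> I \<Longrightarrow> wfin (G i)"
  shows "wcomm l P (\<lambda>x. \<Sum>i\<in>I. c i * G i x) = (\<lambda>x. \<Sum>i\<in>I. c i * wcomm l P (G i) x)"
  unfolding wcomm_def
  using wmul_sum[of I P G l c] assms by (simp add: sum_subtractf right_diff_distrib)

lemma wmul_scale:
  assumes "wfin P" "wfin G"
  shows "wmul l P (\<lambda>x. c * G x) = (\<lambda>x. c * wmul l P G x)"
    and "wmul l (\<lambda>x. c * G x) P = (\<lambda>x. c * wmul l G P x)"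
  using wmul_sum[of "{()}" P "\<lambda>_. G" l "\<lambda>_. c"] assms by simp_all

lemma wcomm_self_left:
  assumes "l \<ge> 1" "wfin P" "wfin A"
  shows "wcomm l P (wmul l P A) = wmul l P (wcomm l P A)"
proof -
  have "wcomm l P P = 0" by (simp add: wcomm_eq_diff)
  moreover have "wmul l 0 A = 0" by (simp add: wmul_def wsupp_def fun_eq_iff)
  ultimately show ?thesis by (simp add: wcomm_Leibniz[OF assms(1)] assms)
qed

text \<open>The scalar \<open>e\<close> is general because the lemma serves both [Q, P] = 1 and
  [P, Q] = -1.\<close>

lemma wcomm_canonical_left:
  assumes l: "l \<ge> 1" and fin: "wfin P" "wfin Q" "wfin A" and PQ: "wcomm l P Q = (\<lambda>x. e * wone x)"
  shows "wcomm l P (wmul l Q A) = (\<lambda>x. e * A x + wmul l Q (wcomm l P A) x)"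
proof -
  have "wmul l (wcomm l P Q) A = (\<lambda>x. e * A x)"
    unfolding PQ by (simp add: wmul_scale wfin_wone fin wmul_wone_left[OF l])
  then show ?thesis by (simp add: wcomm_Leibniz[OF l] fin fun_eq_iff)
qed

section \<open>Iterated commutators with the ordered monomials P^i Q^j\<close>

definition monom_PQ :: "nat \<Rightarrow> 'a::field_char_0 wel \<Rightarrow> 'a wel \<Rightarrow> nat \<Rightarrow> nat \<Rightarrow> 'a wel" where
  "monom_PQ l P Q i j = (wmul l P ^^ i) ((wmul l Q ^^ j) wone)"

lemma wfin_funpow_wmul: "wfin P \<Longrightarrow> wfin A \<Longrightarrow> wfin ((wmul l P ^^ i) A)"
  by (induction i) (simp_all add: wfin_wmul)

lemma wfin_monom_PQ: "wfin P \<Longrightarrow> wfin Q \<Longrightarrow> wfin (monom_PQ l P Q i j)"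
  by (simp add: monom_PQ_def wfin_funpow_wmul wfin_wone)

lemma wcomm_wone: "l \<ge> 1 \<Longrightarrow> wfin P \<Longrightarrow> wcomm l P wone = (\<lambda>_. 0)"
  by (simp add: wcomm_eq_diff wmul_wone_left wmul_wone_right fun_eq_iff)

lemma wmul_0_right: "wmul l P (\<lambda>_. 0) = (\<lambda>_. 0)"
  by (simp add: wmul_def wsupp_def fun_eq_iff)

lemma wcomm_power:
  assumes l: "l \<ge> 1" and fin: "wfin P" "wfin Q" and PQ: "wcomm l P Q = (\<lambda>x. e * wone x)"
  shows "wcomm l P ((wmul l Q ^^ j) wone) = (\<lambda>x. e * of_nat j * (wmul l Q ^^ (j - 1)) wone x)"
proof (induction j)
  case 0
  show ?case using l fin by (simp add: wcomm_wone)
next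
  case (Suc j)
  have "wcomm l P ((wmul l Q ^^ Suc j) wone) =
    (\<lambda>x. e * (wmul l Q ^^ j) wone x + wmul l Q (wcomm l P ((wmul l Q ^^ j) wone)) x)"
    using wcomm_canonical_left[OF l fin _ PQ] by (simp add: wfin_funpow_wmul fin wfin_wone)
  also have "wmul l Q (wcomm l P ((wmul l Q ^^ j) wone)) = (\<lambda>x. e * of_nat j * (wmul l Q ^^ j) wone x)"
    unfolding Suc by (cases j) (simp_all add: wmul_0_right wmul_scale wfin_wmul wfin_funpow_wmul fin wfin_wone)
  finally show ?case by (simp add: algebra_simps)
qed

text \<open>On ordered monomials ad P is e times the derivative in Q. For j = 0 the factor
  \<open>of_nat j\<close> cancels the term whose exponent \<open>j - 1\<close> is truncated.\<close>

lemma wcomm_monom_PQ_left: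
  assumes l: "l \<ge> 1" and fin: "wfin P" "wfin Q" and PQ: "wcomm l P Q = (\<lambda>x. e * wone x)"
  shows "wcomm l P (monom_PQ l P Q i j) = (\<lambda>x. e * of_nat j * monom_PQ l P Q i (j - 1) x)"
proof (induction i)
  case 0
  show ?case using wcomm_power[OF assms] by (simp add: monom_PQ_def)
next
  case (Suc i)
  have "monom_PQ l P Q (Suc i) j = wmul l P (monom_PQ l P Q i j)" for j by (simp add: monom_PQ_def)
  then show ?case
    by (simp add: wcomm_self_left[OF l] Suc wfin_monom_PQ fin wmul_scale)
qed

lemma wcomm_monom_PQ_right:
  assumes l: "l \<ge> 1" and fin: "wfin P" "wfin Q" and QP: "wcomm l Q P = (\<lambda>x. e * wone x)"
  shows "wcomm l Q (monom_PQ l P Q i j) = (\<lambda>x. e * of_nat i * monom_PQ l P Q (i - 1) j x)"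
proof (induction i)
  case 0
  have "wcomm l Q ((wmul l Q ^^ j) wone) = (\<lambda>_. 0)"
    by (induction j) (simp_all add: wcomm_wone[OF l] fin wcomm_self_left[OF l] wfin_funpow_wmul wfin_wone wmul_0_right)
  then show ?case by (simp add: monom_PQ_def)
next
  case (Suc i)
  have M: "monom_PQ l P Q (Suc i) j = wmul l P (monom_PQ l P Q i j)" for i j by (simp add: monom_PQ_def)
  have "wcomm l Q (monom_PQ l P Q (Suc i) j) =
      (\<lambda>x. e * monom_PQ l P Q i j x + wmul l P (wcomm l Q (monom_PQ l P Q i j)) x)"
    unfolding M by (rule wcomm_canonical_left[OF l fin(2,1) wfin_monom_PQ[OF fin] QP])
  also have "wmul l P (wcomm l Q (monom_PQ l P Q i j)) = (\<lambda>x. e * of_nat i * monom_PQ l P Q i j x)"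
    unfolding Suc by (cases i) (simp_all add: wmul_0_right wmul_scale wfin_monom_PQ fin M)
  finally show ?case by (simp add: algebra_simps)
qed

text \<open>The shifts k and m record how often ad Q and ad P have been applied. The index set stays
  the original box, so that only the coefficients change; where a shifted exponent is truncated, the
  factor \<open>ffact\<close> from the differentiation is 0.\<close>

definition wcomb :: "nat \<Rightarrow> 'a::field_char_0 wel \<Rightarrow> 'a wel \<Rightarrow> nat \<Rightarrow> (nat \<times> nat \<Rightarrow> 'a) \<Rightarrow> nat \<Rightarrow> nat \<Rightarrow> 'a wel" where
  "wcomb l P Q N c k m = (\<lambda>x. \<Sum>y\<in>{..N} \<times> {..N}. c y * monom_PQ l P Q (fst y - k) (snd y - m) x)"

lemma wfin_wcomb: "wfin P \<Longrightarrow> wfin Q \<Longrightarrow> wfin (wcomb l P Q N c k m)"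
  unfolding wcomb_def by (rule wfin_sum) (auto simp: wfin_monom_PQ)

definition ffact :: "'a::field_char_0 \<Rightarrow> nat \<Rightarrow> nat \<Rightarrow> 'a" where
  "ffact e k j = (\<Prod>t<k. e * of_nat (j - t))"

lemma ffact_eq_0: "j < k \<Longrightarrow> ffact e k j = 0"
  unfolding ffact_def by (rule prod_zero) (auto intro!: bexI[of _ j])

lemma ffact_neq_0: "e \<noteq> 0 \<Longrightarrow> k \<le> j \<Longrightarrow> ffact e k j \<noteq> 0"
  by (auto simp: ffact_def)

lemma funpow_wcomm_left_wcomb:
  assumes l: "l \<ge> 1" and fin: "wfin P" "wfin Q" and PQ: "wcomm l P Q = (\<lambda>x. e * wone x)"
  shows "(wcomm l P ^^ m) (wcomb l P Q N c k 0) = wcomb l P Q N (\<lambda>y. c y * ffact e m (snd y)) k m"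
proof (induction m)
  case (Suc m)
  have "(wcomm l P ^^ Suc m) (wcomb l P Q N c k 0) = wcomm l P (wcomb l P Q N (\<lambda>y. c y * ffact e m (snd y)) k m)"
    using Suc by simp
  also have "\<dots> = wcomb l P Q N (\<lambda>y. c y * ffact e (Suc m) (snd y)) k (Suc m)"
    unfolding wcomb_def
    by (subst wcomm_sum) (simp_all add: fin wfin_monom_PQ wcomm_monom_PQ_left[OF assms] ffact_def mult_ac)
  finally show ?case .
qed (simp add: wcomb_def ffact_def)

lemma funpow_wcomm_right_wcomb:
  assumes l: "l \<ge> 1" and fin: "wfin P" "wfin Q" and QP: "wcomm l Q P = (\<lambda>x. e * wone x)"
  shows "(wcomm l Q ^^ k) (wcomb l P Q N c 0 m) = wcomb l P Q N (\<lambda>y. c y * ffact e k (fst y)) k m"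
proof (induction k)
  case (Suc k)
  have "(wcomm l Q ^^ Suc k) (wcomb l P Q N c 0 m) = wcomm l Q (wcomb l P Q N (\<lambda>y. c y * ffact e k (fst y)) k m)"
    using Suc by simp
  also have "\<dots> = wcomb l P Q N (\<lambda>y. c y * ffact e (Suc k) (fst y)) (Suc k) m"
    unfolding wcomb_def
    by (subst wcomm_sum) (simp_all add: fin wfin_monom_PQ wcomm_monom_PQ_right[OF assms] ffact_def mult_ac)
  finally show ?case .
qed (simp add: wcomb_def ffact_def)

text \<open>Choose an exponent z of largest total degree among those with nonzero coefficient and
  differentiate exactly z times. Another exponent survives only if it dominates z in both entries,
  which maximality forbids.\<close>

lemma iterated_wcomm_wcomb:
  assumes l: "l \<ge> 1" and fin: "wfin P" "wfin Q" and QP: "wcomm l Q P = wone"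
    and c: "y0 \<in> {..N} \<times> {..N}" "c y0 \<noteq> 0"
  obtains i j d where "i \<le> N" "j \<le> N" "d \<noteq> 0"
    "(wcomm l Q ^^ i) ((wcomm l P ^^ j) (wcomb l P Q N c 0 0)) = (\<lambda>x. d * wone x)"
proof -
  define I where "I = {y \<in> {..N} \<times> {..N}. c y \<noteq> 0}"
  have "finite I" "y0 \<in> I" using c by (auto simp: I_def)
  then obtain z where z: "z \<in> I" and zmax: "\<And>y. y \<in> I \<Longrightarrow> fst y + snd y \<le> fst z + snd z"
    using ex_has_greatest_nat[of "\<lambda>y. y \<in> I" y0 "\<lambda>y. fst y + snd y" "Suc (2 * N)"]
    by (force simp: I_def less_Suc_eq_le)
  have PQ: "wcomm l P Q = (\<lambda>x. (-1) * wone x)" and QP': "wcomm l Q P = (\<lambda>x. 1 * wone x)"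
    using QP by (auto simp: wcomm_def fun_eq_iff algebra_simps)
  define c' where "c' = (\<lambda>y. c y * ffact (-1) (snd z) (snd y) * ffact 1 (fst z) (fst y))"
  have "(wcomm l Q ^^ fst z) ((wcomm l P ^^ snd z) (wcomb l P Q N c 0 0)) = wcomb l P Q N c' (fst z) (snd z)"
    by (simp add: funpow_wcomm_left_wcomb[OF l fin PQ] funpow_wcomm_right_wcomb[OF l fin QP'] c'_def)
  also have "\<dots> = (\<lambda>x. c' z * wone x)"
  proof
    fix x
    have "c' y = 0" if "y \<in> {..N} \<times> {..N}" "y \<noteq> z" for y
    proof (rule ccontr)
      assume "c' y \<noteq> 0"
      then have "c y \<noteq> 0" "\<not> snd y < snd z" "\<not> fst y < fst z"
        by (auto simp: c'_def ffact_eq_0)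
      moreover from this have "fst y + snd y \<le> fst z + snd z" using zmax[of y] that by (simp add: I_def)
      ultimately show False using that(2) by (simp add: prod_eq_iff)
    qed
    then have "wcomb l P Q N c' (fst z) (snd z) x =
       (\<Sum>y\<in>{..N} \<times> {..N}. if z = y then c' y * monom_PQ l P Q (fst y - fst z) (snd y - snd z) x else 0)"
      unfolding wcomb_def by (intro sum.cong) auto
    also have "\<dots> = c' z * wone x"
      using z by (subst sum.delta') (auto simp: I_def monom_PQ_def)
    finally show "wcomb l P Q N c' (fst z) (snd z) x = c' z * wone x" .
  qed
  finally have "(wcomm l Q ^^ fst z) ((wcomm l P ^^ snd z) (wcomb l P Q N c 0 0)) = (\<lambda>x. c' z * wone x)" .
  moreover have "c' z \<noteq> 0" using z by (simp add: c'_def I_def ffact_neq_0)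
  moreover have "fst z \<le> N" "snd z \<le> N" using z by (auto simp: I_def)
  ultimately show ?thesis using that by blast
qed

lemma funpow_wcomm_wcomb_eq_0:
  assumes l: "l \<ge> 1" and fin: "wfin P" "wfin Q" and PQ: "wcomm l P Q = (\<lambda>x. e * wone x)"
  shows "(wcomm l P ^^ Suc N) (wcomb l P Q N c k 0) = (\<lambda>_. 0)"
  unfolding funpow_wcomm_left_wcomb[OF assms]
  by (auto simp: wcomb_def fun_eq_iff ffact_eq_0 intro!: sum.neutral)

section \<open>The Poisson bracket of homogeneous elements\<close>

text \<open>Setting x = 1 identifies a homogeneous element of L^(l) with a polynomial in y. Up to the
  factor 1/(rho l), the Poisson bracket of elements of weights u and v then becomes the following.\<close>

definition pbr :: "'a::field_char_0 \<Rightarrow> 'a \<Rightarrow> 'a poly \<Rightarrow> 'a poly \<Rightarrow> 'a poly" where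
  "pbr u v p g = smult v (pderiv p * g) - smult u (p * pderiv g)"

lemma pbr_self: "pbr u u p p = 0"
  by (simp add: pbr_def mult.commute)

lemma pbr_mult: "pbr u (v + w) p (g * h) = pbr u v p g * h + g * pbr u w p h"
  by (simp add: pbr_def pderiv_mult algebra_simps smult_add_left smult_add_right)

text \<open>The extra factor \<pi> on the left avoids the exponent m - 1, so the formula also covers
  m = 0.\<close>

lemma mult_pderiv_power_mult:
  fixes \<pi> h :: "'a::field_char_0 poly"
  shows "\<pi> * pderiv (\<pi> ^ m * h) = \<pi> ^ m * (smult (of_nat m) (pderiv \<pi> * h) + \<pi> * pderiv h)"
proof (cases m)
  case (Suc n)
  show ?thesis unfolding Suc pderiv_mult pderiv_power_Suc
    by (simp add: algebra_simps)
qed simp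

text \<open>After multiplication by \<pi>, the bracket is \<pi>^(a+m) times (v a - u m) \<pi>' p h
  plus a multiple of \<pi>. The divisibility assumption makes \<pi> divide this cofactor, and \<pi>
  divides none of \<pi>', p, h, so the scalar is 0.\<close>

lemma pbr_multiplicity:
  fixes \<pi> p h :: "'a::field_char_0 poly"
  assumes prime: "prime_elem \<pi>" and sep: "\<not> \<pi> dvd pderiv \<pi>"
    and nd: "\<not> \<pi> dvd p" "\<not> \<pi> dvd h"
    and dvd: "\<pi> ^ (a + m) dvd pbr u v (\<pi> ^ a * p) (\<pi> ^ m * h)"
  shows "u * of_nat m = v * of_nat a"
proof (rule ccontr)
  assume neq: "u * of_nat m \<noteq> v * of_nat a"
  define c where "c = v * of_nat a - u * of_nat m"
  define Y where "Y = smult v (pderiv p * h) - smult u (p * pderiv h)"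
  from dvd obtain Z where Z: "pbr u v (\<pi> ^ a * p) (\<pi> ^ m * h) = \<pi> ^ (a + m) * Z" by (elim dvdE)
  have "\<pi> * pbr u v (\<pi> ^ a * p) (\<pi> ^ m * h) =
      smult v ((\<pi> * pderiv (\<pi> ^ a * p)) * (\<pi> ^ m * h)) - smult u ((\<pi> ^ a * p) * (\<pi> * pderiv (\<pi> ^ m * h)))"
    by (simp add: pbr_def algebra_simps)
  also have "\<dots> = \<pi> ^ (a + m) * (smult c (pderiv \<pi> * (p * h)) + \<pi> * Y)"
    unfolding mult_pderiv_power_mult Y_def c_def
    by (simp add: power_add algebra_simps smult_diff_left smult_add_right smult_diff_right)
  finally have "\<pi> ^ (a + m) * (\<pi> * Z) = \<pi> ^ (a + m) * (smult c (pderiv \<pi> * (p * h)) + \<pi> * Y)"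
    by (simp add: Z mult.left_commute)
  then have "\<pi> * Z = smult c (pderiv \<pi> * (p * h)) + \<pi> * Y"
    using prime by auto
  then have "smult c (pderiv \<pi> * (p * h)) = \<pi> * (Z - Y)" by (simp add: algebra_simps)
  then have "\<pi> dvd smult c (pderiv \<pi> * (p * h))" by simp
  then have "\<pi> dvd pderiv \<pi> * (p * h)" using neq by (simp add: dvd_smult_iff c_def)
  then show False using prime sep nd by (simp add: prime_elem_dvd_mult_iff)
qed

text \<open>A nonconstant divisor of least degree is irreducible. In characteristic zero its
  derivative is nonzero and of smaller degree, so \<pi> cannot divide it.\<close>

lemma exists_prime_factor:
  fixes e :: "'a::field_char_0 poly"
  assumes "degree e > 0"
  obtains \<pi> where "prime_elem \<pi>" "\<pi> dvd e" "\<not> \<pi> dvd pderiv \<pi>"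
proof -
  obtain \<pi> where \<pi>: "\<pi> dvd e" "degree \<pi> > 0"
    and min: "\<And>d. d dvd e \<Longrightarrow> degree d > 0 \<Longrightarrow> degree \<pi> \<le> degree d"
    using ex_has_least_nat[of "\<lambda>d. d dvd e \<and> degree d > 0" e degree] assms by auto
  have nz: "\<pi> \<noteq> 0" using \<pi> by auto
  have "irreducible \<pi>"
  proof (rule irreducibleI)
    show "\<pi> \<noteq> 0" by fact
    show "\<not> \<pi> dvd 1" using \<pi> is_unit_iff_degree[OF nz] by simp
    fix a b assume ab: "\<pi> = a * b"
    then have ab0: "a \<noteq> 0" "b \<noteq> 0" using nz by auto
    then have deg: "degree \<pi> = degree a + degree b" by (simp add: ab degree_mult_eq)
    have "degree a = 0 \<or> degree b = 0"
    proof (rule ccontr)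
      assume "\<not> ?thesis"
      moreover have "a dvd e" using \<pi>(1) ab by (metis dvd_mult_left)
      ultimately show False using min[of a] deg by simp
    qed
    then show "a dvd 1 \<or> b dvd 1" using ab0 is_unit_iff_degree by blast
  qed
  then have "prime_elem \<pi>" by (rule field_poly_irreducible_imp_prime)
  moreover have "\<not> \<pi> dvd pderiv \<pi>"
  proof
    assume "\<pi> dvd pderiv \<pi>"
    moreover have "pderiv \<pi> \<noteq> 0" using \<pi> by (simp add: pderiv_eq_0_iff)
    ultimately have "degree \<pi> \<le> degree (pderiv \<pi>)" by (rule dvd_imp_degree_le)
    then show False using \<pi> by (simp add: degree_pderiv)
  qed
  ultimately show ?thesis using that \<pi> by blast
qed

lemma prime_power_decompose:
  fixes x :: "'a::field_char_0 poly"
  assumes "prime_elem \<pi>" "x \<noteq> 0"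
  obtains k y where "x = \<pi> ^ k * y" "\<not> \<pi> dvd y"
proof -
  have \<pi>: "\<pi> \<noteq> 0" "degree \<pi> > 0"
    using assms(1) is_unit_iff_degree[of \<pi>] by (auto simp: prime_elem_def)
  have "\<exists>k y. x = \<pi> ^ k * y \<and> \<not> \<pi> dvd y"
    using assms(2)
  proof (induction "degree x" arbitrary: x rule: less_induct)
    case less
    show ?case
    proof (cases "\<pi> dvd x")
      case True
      then obtain z where z: "x = \<pi> * z" by (elim dvdE)
      then have "degree z < degree x" "z \<noteq> 0" using less.prems \<pi> by (auto simp: degree_mult_eq)
      then obtain k y where "z = \<pi> ^ k * y" "\<not> \<pi> dvd y" using less.hyps by blast
      then show ?thesis using z by (intro exI[of _ "Suc k"] exI[of _ y]) (simp add: mult.assoc)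
    next
      case False
      then show ?thesis by (intro exI[of _ 0] exI[of _ x]) simp
    qed
  qed
  then show ?thesis using that by blast
qed

text \<open>A pole of S/E at a prime dividing E would contradict the orders forced by both bracket equations.\<close>

lemma bracket_quotient_polynomial:
  fixes p e s :: "'a::field_char_0 poly" and u v \<delta> :: int
  assumes u: "u > 0" and \<delta>: "\<delta> \<ge> 0" and p: "p \<noteq> 0" and e: "e \<noteq> 0"
    and pe: "pbr (of_int u) (of_int v) p e = 0"
    and ps: "pbr (of_int u) (of_int (v + \<delta>)) p s = smult c (p * e)"
  shows "e dvd s"
proof (cases "s = 0")
  case False
  \<comment> \<open>A common divisor of largest degree acts as a gcd: its maximality keeps a prime
    factor of \<open>e1\<close> from dividing \<open>s1\<close>.\<close>
  have "\<exists>g. (g dvd e \<and> g dvd s) \<and> (\<forall>y. y dvd e \<and> y dvd s \<longrightarrow> degree y \<le> degree g)"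
    by (rule ex_has_greatest_nat[of _ 1 _ "Suc (degree e)"])
      (use e dvd_imp_degree_le in \<open>auto simp: less_Suc_eq_le\<close>)
  then obtain g where g: "g dvd e" "g dvd s"
    and max: "\<And>y. y dvd e \<Longrightarrow> y dvd s \<Longrightarrow> degree y \<le> degree g"
    by blast
  obtain e1 s1 where es: "e = g * e1" "s = g * s1" using g by (elim dvdE)
  have nz: "g \<noteq> 0" "e1 \<noteq> 0" "s1 \<noteq> 0" using es e False by auto
  have "degree e1 = 0"
  proof (rule ccontr)
    assume "degree e1 \<noteq> 0"
    then obtain \<pi> where \<pi>: "prime_elem \<pi>" "\<pi> dvd e1" "\<not> \<pi> dvd pderiv \<pi>"
      using exists_prime_factor[of e1] by auto
    have pz: "\<pi> \<noteq> 0" and "\<not> is_unit \<pi>" using \<pi>(1) by (auto simp: prime_elem_def)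
    then have dpi: "degree \<pi> > 0" using is_unit_iff_degree by blast
    have ns1: "\<not> \<pi> dvd s1"
    proof
      assume "\<pi> dvd s1"
      then have "degree (g * \<pi>) \<le> degree g" using max[of "g * \<pi>"] \<pi> es by simp
      then show False using dpi nz pz by (simp add: degree_mult_eq)
    qed
    obtain k g0 where g0: "g = \<pi> ^ k * g0" "\<not> \<pi> dvd g0"
      using prime_power_decompose[OF \<pi>(1) nz(1)] .
    obtain j e0 where e0: "e1 = \<pi> ^ j * e0" "\<not> \<pi> dvd e0"
      using prime_power_decompose[OF \<pi>(1) nz(2)] .
    obtain a p0 where p0: "p = \<pi> ^ a * p0" "\<not> \<pi> dvd p0"
      using prime_power_decompose[OF \<pi>(1) p] .
    have j: "j > 0" using \<pi>(2) e0 by (cases j) auto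
    have E: "e = \<pi> ^ (k + j) * (g0 * e0)" by (simp add: es g0(1) e0(1) power_add)
    have S: "s = \<pi> ^ k * (g0 * s1)" by (simp add: es g0(1))
    have ndE: "\<not> \<pi> dvd g0 * e0" "\<not> \<pi> dvd g0 * s1"
      using \<pi>(1) g0 e0 ns1 by (simp_all add: prime_elem_dvd_mult_iff)
    have "of_int u * of_nat (k + j) = (of_int v * of_nat a :: 'a)"
      by (rule pbr_multiplicity[OF \<pi>(1,3) p0(2) ndE(1)]) (use pe in \<open>simp add: E p0\<close>)
    then have "of_int (u * int (k + j)) = (of_int (v * int a) :: 'a)" by simp
    then have 1: "u * int (k + j) = v * int a" by (simp only: of_int_eq_iff)
    \<comment> \<open>The right side p e contains even \<pi>^(a+k+j), so the multiplicity lemma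
      applies although this bracket need not vanish.\<close>
    have "\<pi> ^ (a + k) dvd pbr (of_int u) (of_int (v + \<delta>)) (\<pi> ^ a * p0) (\<pi> ^ k * (g0 * s1))"
      unfolding p0(1)[symmetric] S[symmetric] ps
      by (intro dvd_smult) (auto simp: p0(1) E power_add intro!: mult_dvd_mono)
    then have "of_int u * of_nat k = (of_int (v + \<delta>) * of_nat a :: 'a)"
      by (rule pbr_multiplicity[OF \<pi>(1,3) p0(2) ndE(2)])
    then have "of_int (u * int k) = (of_int ((v + \<delta>) * int a) :: 'a)" by simp
    then have 2: "u * int k = (v + \<delta>) * int a" by (simp only: of_int_eq_iff)
    \<comment> \<open>The orders satisfy u (k + j) = v a, which is at most (v + \<delta>) a = u k,
      against j > 0.\<close>
    have "u * int (k + j) \<le> u * int k" 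
      unfolding 1 2 using \<delta> by (simp add: mult_right_mono)
    then show False using u j by simp
  qed
  then have "is_unit e1" using nz is_unit_iff_degree by blast
  then show ?thesis using es by (metis dvd_triv_left mult_unit_dvd_iff)
qed simp

text \<open>With u = d b, the coefficient of y^(b-1) in the bracket is d b p0(0) f(0), so f(0) = 0.
  Then the two contributions of f'(0) to y^b cancel, whereas the right side has r p0(0)
  there.\<close>

lemma pbr_neq_if_diagonal:
  fixes p f :: "'a::field_char_0 poly"
  assumes p: "p = [:0, 1:] ^ b * p0" "\<not> [:0, 1:] dvd p0" and b: "b > 0" and d: "d \<noteq> 0" and r: "r \<noteq> 0"
  shows "pbr (d * of_nat b) d p f \<noteq> smult r p"
proof
  define X where "X = [:0, 1 :: 'a:]"
  define B where "B = (of_nat b :: 'a)"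
  assume eq: "pbr (d * of_nat b) d p f = smult r p"
  have X0: "X ^ b \<noteq> 0" "X \<noteq> 0" by (simp_all add: X_def)
  have "X * pbr (d * B) d p f = smult d ((X * pderiv (X ^ b * p0)) * f) - smult (d * B) (X ^ b * (X * p0 * pderiv f))"
    by (simp add: pbr_def p(1) X_def algebra_simps)
  also have "\<dots> = X ^ b * (smult d (smult B p0 * f + X * pderiv p0 * f) - smult (d * B) (X * p0 * pderiv f))"
    unfolding mult_pderiv_power_mult B_def[symmetric]
    by (simp add: X_def pderiv_pCons algebra_simps smult_add_right)
  finally have "X ^ b * (smult d (smult B p0 * f + X * pderiv p0 * f) - smult (d * B) (X * p0 * pderiv f))
      = X ^ b * smult r (X * p0)"
    using eq by (simp add: B_def p(1) X_def mult.left_commute)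
  then have 1: "smult d (smult B p0 * f + X * pderiv p0 * f) - smult (d * B) (X * p0 * pderiv f) = smult r (X * p0)"
    using X0 by (simp only: mult_cancel_left) simp
  have p00: "poly p0 0 \<noteq> 0" using p(2) by (simp add: dvd_iff_poly_eq_0)
  have "poly f 0 = 0"
    using arg_cong[OF 1, of "\<lambda>q. poly q 0"] p00 d b by (simp add: X_def B_def)
  then have "X dvd f" by (simp add: dvd_iff_poly_eq_0 X_def)
  then obtain h where h: "f = X * h" by (elim dvdE)
  have "pderiv f = h + X * pderiv h" by (simp add: h pderiv_mult X_def pderiv_pCons)
  then have "X * (X * (smult d (pderiv p0 * h) - smult (d * B) (p0 * pderiv h))) = X * smult r p0"
    using 1 by (simp add: h algebra_simps smult_add_right smult_diff_right)
  then have "X * (smult d (pderiv p0 * h) - smult (d * B) (p0 * pderiv h)) = smult r p0"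
    using X0(2) by (simp only: mult_cancel_left) simp
  from arg_cong[OF this, of "\<lambda>q. poly q 0"] show False
    using p00 r by (simp add: X_def)
qed

lemma pbr_smult: "pbr u v (smult c f) (smult d g) = smult (c * d) (pbr u v f g)"
  by (simp add: pbr_def pderiv_smult smult_diff_right mult_ac)

lemma smult_sum_right: "smult c (sum h S) = (\<Sum>x\<in>S. smult c (h x))"
  by (induction S rule: infinite_finite_induct) (auto simp: smult_add_right)

lemma pderiv_sum_right: "pderiv (sum h S) = (\<Sum>x\<in>S. pderiv (h x))"
  by (induction S rule: infinite_finite_induct) (auto simp: pderiv_add)

lemma pbr_sum: "pbr u v (\<Sum>p\<in>A. f p) (\<Sum>q\<in>B. g q) = (\<Sum>p\<in>A. \<Sum>q\<in>B. pbr u v (f p) (g q))"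
  by (simp add: pbr_def pderiv_sum_right sum_product smult_sum_right sum_subtractf)

lemma pbr_0_left [simp]: "pbr u v 0 g = 0" and pbr_0_right [simp]: "pbr u v p 0 = 0"
  by (simp_all add: pbr_def)

text \<open>By Euler's formula for homogeneous elements, p and q with vanishing bracket have proportional
  logarithmic derivatives, so bracketing with F multiplies q by w/u if it fixes p.\<close>

lemma pbr_proportional:
  fixes p q f :: "'a::field_char_0 poly"
  assumes p: "p \<noteq> 0" and u: "u \<noteq> 0" and pq: "pbr u w p q = 0" and pf: "pbr u d p f = smult r p"
  shows "pbr w d q f = smult r (smult (w / u) q)"
proof -
  have pq': "smult u (p * pderiv q) = smult w (pderiv p * q)" using pq by (simp add: pbr_def)
  have "p * smult u (pbr w d q f) = smult d (smult u (p * pderiv q) * f) - smult (u * w) (p * q * pderiv f)"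
    by (simp add: pbr_def algebra_simps smult_diff_right)
  also have "\<dots> = smult w (q * pbr u d p f)"
    unfolding pq' by (simp add: pbr_def algebra_simps smult_diff_right)
  also have "\<dots> = p * smult (w * r) q" by (simp add: pf mult.commute)
  finally have "smult u (pbr w d q f) = smult (w * r) q" using p by (simp only: mult_cancel_left) simp
  then have "smult (1 / u) (smult u (pbr w d q f)) = smult (1 / u) (smult (w * r) q)" by simp
  then show ?thesis using u by (simp add: mult.commute)
qed

text \<open>Both descriptions of the order b at y = 0 are used: the factorization for brackets, the
  lowest coefficient for locating a support point.\<close>

lemma order_0_decompose:
  fixes p :: "'a::field_char_0 poly"
  assumes "p \<noteq> 0"
  obtains b p0 where "p = [:0, 1:] ^ b * p0" "\<not> [:0, 1:] dvd p0" "coeff p b \<noteq> 0" "\<forall>i<b. coeff p i = 0"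
proof -
  have X: "prime_elem [:0, 1 :: 'a:]" by (rule prime_elem_linear_field_poly) simp
  obtain b p0 where p: "p = [:0, 1:] ^ b * p0" "\<not> [:0, 1:] dvd p0"
    using prime_power_decompose[OF X assms] .
  have p': "p = monom 1 b * p0" by (simp add: p(1) monom_altdef)
  have "coeff p0 0 \<noteq> 0" using p(2) by (simp add: dvd_iff_poly_eq_0 poly_0_coeff_0)
  then have "coeff p b \<noteq> 0" "\<forall>i<b. coeff p i = 0"
    by (simp_all add: p' coeff_monom_mult)
  then show ?thesis using that p by blast
qed

lemma homogeneous_system_nontrivial:
  fixes A :: "'v \<Rightarrow> 'i \<Rightarrow> 'a::field"
  assumes "finite V" "finite I" "card V < card I"
  shows "\<exists>c. (\<exists>i\<in>I. c i \<noteq> 0) \<and> (\<forall>v\<in>V. (\<Sum>i\<in>I. c i * A v i) = 0)"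
  using assms
proof (induction V arbitrary: I A rule: finite_induct)
  case empty
  then obtain i where "i \<in> I" by fastforce
  then show ?case by (intro exI[of _ "\<lambda>_. 1"]) auto
next
  case (insert w V)
  show ?case
  proof (cases "\<forall>i\<in>I. A w i = 0")
    case True
    then show ?thesis using insert.IH[of I A] insert by force
  next
    case False
    then obtain k where k: "k \<in> I" "A w k \<noteq> 0" by blast
    \<comment> \<open>The equation of \<open>w\<close> is solved for unknown \<open>k\<close>;
      \<open>A'\<close> is the system left after the substitution.\<close>
    define A' where "A' v i = A v i - A v k * A w i / A w k" for v i
    have "card V < card (I - {k})" using insert k by simp
    then obtain c where c: "\<exists>i\<in>I - {k}. c i \<noteq> 0" "\<forall>v\<in>V. (\<Sum>i\<in>I - {k}. c i * A' v i) = 0"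
      using insert.IH[of "I - {k}" A'] insert.prems by auto
    define d where "d i = (if i = k then - (\<Sum>i\<in>I - {k}. c i * A w i) / A w k else c i)" for i
    have sum_d: "(\<Sum>i\<in>I. d i * A v i) =
        (\<Sum>i\<in>I - {k}. c i * A v i) - (\<Sum>i\<in>I - {k}. c i * A w i) / A w k * A v k" for v
    proof -
      have "(\<Sum>i\<in>I. d i * A v i) = d k * A v k + (\<Sum>i\<in>I - {k}. d i * A v i)"
        using insert.prems k by (simp add: sum.remove)
      also have "(\<Sum>i\<in>I - {k}. d i * A v i) = (\<Sum>i\<in>I - {k}. c i * A v i)"
        by (rule sum.cong) (auto simp: d_def)
      finally show ?thesis by (simp add: d_def)
    qed
    have "(\<Sum>i\<in>I. d i * A v i) = (\<Sum>i\<in>I - {k}. c i * A' v i)" for v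
      unfolding sum_d A'_def
      by (simp add: sum_subtractf right_diff_distrib sum_divide_distrib sum_distrib_left mult_ac)
    then have "\<forall>v\<in>V. (\<Sum>i\<in>I. d i * A v i) = 0" using c by simp
    moreover have "(\<Sum>i\<in>I. d i * A w i) = 0" using k by (simp add: sum_d)
    moreover have "\<exists>i\<in>I. d i \<noteq> 0" using c by (auto simp: d_def)
    ultimately show ?thesis by blast
  qed
qed

section \<open>Weights and leading terms\<close>

locale weights =
  fixes l :: nat and \<rho> \<sigma> :: int
  assumes l: "l \<ge> 1" and \<rho>: "\<rho> > 0" and \<rho>\<sigma>: "\<rho> + \<sigma> > 0"
begin

text \<open>Weights are l times the degrees of the paper, which makes them integers.\<close>

definition wt :: "int \<times> nat \<Rightarrow> int" where
  "wt x = \<rho> * fst x + \<sigma> * int l * int (snd x)"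

text \<open>This is the weight of X Y, which is what one contraction of a Y with a power of X
  removes.\<close>

definition \<delta> :: int where
  "\<delta> = int l * (\<rho> + \<sigma>)"

text \<open>An upper bound survives cancellation and makes sense for 0. Together with a nonzero
  \<open>hat w G\<close> it says that the weight of G is exactly w.\<close>

definition wle :: "int \<Rightarrow> 'a::field_char_0 wel \<Rightarrow> bool" where
  "wle w G \<longleftrightarrow> (\<forall>x. w < wt x \<longrightarrow> G x = 0)"

definition mon :: "int \<Rightarrow> int \<times> nat \<Rightarrow> 'a::field_char_0 poly" where
  "mon w x = (if wt x = w then monom 1 (snd x) else 0)"

text \<open>The part of weight w at x = 1, possibly 0. Nothing is lost for fixed w: since \<rho> >
  0, weight and Y-exponent determine the X-exponent.\<close>

definition hat :: "int \<Rightarrow> 'a::field_char_0 wel \<Rightarrow> 'a poly" where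
  "hat w G = (\<Sum>x\<in>wsupp G. smult (G x) (mon w x))"

lemma \<delta>_pos: "\<delta> > 0"
  using l \<rho>\<sigma> by (simp add: \<delta>_def)

lemma wt_inj: "wt (i, j) = wt (i', j) \<Longrightarrow> i = i'"
  using \<rho> by (simp add: wt_def)

lemma hat_superset:
  "finite U \<Longrightarrow> wsupp G \<subseteq> U \<Longrightarrow> hat w G = (\<Sum>x\<in>U. smult (G x) (mon w x))"
  unfolding hat_def by (rule sum.mono_neutral_left) (auto simp: wsupp_def)

lemma coeff_mon: "coeff (mon w x) j = (if wt x = w \<and> snd x = j then 1 else 0)"
  by (simp add: mon_def)

lemma coeff_hat:
  assumes "wfin G" "wt (i, j) = w"
  shows "coeff (hat w G) j = G (i, j)"
proof -
  have "coeff (hat w G) j = (\<Sum>x\<in>wsupp G. if (i, j) = x then G x else 0)"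
    unfolding hat_def coeff_sum
    by (rule sum.cong) (use assms in \<open>auto simp: coeff_mon dest: wt_inj\<close>)
  also have "\<dots> = G (i, j)"
    using assms by (subst sum.delta') (auto simp: wfin_def wsupp_def)
  finally show ?thesis .
qed

lemma coeff_hat_eq_0:
  assumes "\<And>i. wt (i, j) \<noteq> w"
  shows "coeff (hat w (G :: 'a::field_char_0 wel)) j = 0"
proof -
  have "coeff (mon w x) j = (0 :: 'a)" for x
    using assms[of "fst x"] by (auto simp: coeff_mon)
  then show ?thesis by (simp add: hat_def coeff_sum)
qed

lemma coeff_hat_neq_0D:
  assumes "wfin G" "coeff (hat w G) j \<noteq> 0"
  shows "\<exists>i. wt (i, j) = w \<and> G (i, j) \<noteq> 0"
  using assms coeff_hat[OF assms(1)] coeff_hat_eq_0[of j w G] by force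

lemma hat_eq_0_iff:
  assumes "wfin G"
  shows "hat w G = 0 \<longleftrightarrow> (\<forall>x. wt x = w \<longrightarrow> G x = 0)"
proof
  assume "hat w G = 0"
  then show "\<forall>x. wt x = w \<longrightarrow> G x = 0" using coeff_hat[OF assms, of _ _ w] by simp
next
  assume *: "\<forall>x. wt x = w \<longrightarrow> G x = 0"
  show "hat w G = 0"
    by (rule poly_eqI, rule ccontr) (use coeff_hat_neq_0D[OF assms] * in force)
qed

lemma hat_diff: "wfin G \<Longrightarrow> wfin H \<Longrightarrow> hat w (G - H) = hat w G - hat w H"
proof -
  assume "wfin G" "wfin H"
  then have "finite (wsupp G \<union> wsupp H)" "wsupp (G - H) \<subseteq> wsupp G \<union> wsupp H"
    by (auto simp: wfin_def wsupp_def)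
  then show ?thesis
    by (simp add: hat_superset[of "wsupp G \<union> wsupp H"] smult_diff_left sum_subtractf)
qed

lemma wle_wtD: "wle u P \<Longrightarrow> x \<in> wsupp P \<Longrightarrow> wt x \<le> u"
  by (rule ccontr) (simp add: wle_def wsupp_def not_le del: split_paired_All)

lemma wle_mono: "wle u G \<Longrightarrow> u \<le> v \<Longrightarrow> wle v G"
  by (auto simp: wle_def)

lemma wt_mulpos: "k \<le> snd p \<Longrightarrow> wt (mulpos l p q k) = wt p + wt q - int k * \<delta>"
  by (simp add: wt_def mulpos_def \<delta>_def algebra_simps of_nat_diff)

lemma wle_wmul:
  assumes "wfin P" "wfin Q" "wle u P" "wle v Q"
  shows "wle (u + v) (wmul l P Q)"
  unfolding wle_def
proof (intro allI impI, rule ccontr)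
  fix x assume x: "u + v < wt x" and "wmul l P Q x \<noteq> 0"
  then have "x \<in> wsupp (wmul l P Q)" by (simp add: wsupp_def)
  then obtain p q k where p: "p \<in> wsupp P" and q: "q \<in> wsupp Q" and k: "k \<le> snd p" "x = mulpos l p q k"
    using wsupp_wmul_subset[OF assms(1,2), of l] by blast
  have "wt p \<le> u" using p assms(3) by (rule wle_wtD[rotated])
  moreover have "wt q \<le> v" using q assms(4) by (rule wle_wtD[rotated])
  moreover have "0 \<le> int k * \<delta>" using \<delta>_pos by simp
  ultimately show False using x wt_mulpos[OF k(1), of q] unfolding k(2) by linarith
qed

definition hprod :: "int \<Rightarrow> int \<times> nat \<Rightarrow> int \<times> nat \<Rightarrow> 'a::field_char_0 poly" where
  "hprod w p q = (\<Sum>k\<le>snd p. smult (mulcoeff l p q k) (mon w (mulpos l p q k)))"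

lemma hat_wmul:
  assumes "wfin P" "wfin Q"
  shows "hat w (wmul l P Q) = (\<Sum>p\<in>wsupp P. \<Sum>q\<in>wsupp Q. smult (P p * Q q) (hprod w p q))"
proof (rule poly_eqI)
  fix n
  show "coeff (hat w (wmul l P Q)) n = coeff (\<Sum>p\<in>wsupp P. \<Sum>q\<in>wsupp Q. smult (P p * Q q) (hprod w p q)) n"
    using sum_wmul[OF assms, of "wsupp (wmul l P Q)" l "\<lambda>x. coeff (mon w x) n"] wfin_wmul[OF assms, of l]
    by (simp add: hat_def hprod_def coeff_sum wfin_def)
qed

text \<open>Term k of the product has weight \<open>wt p + wt q\<close> - k \<delta>, so this weight
  selects k = 1.\<close>

lemma hprod_top:
  assumes "w = wt p + wt q - \<delta>"
  shows "hprod w p q = smult (of_nat (snd p) * (of_int (fst q) / of_nat l)) (monom 1 (snd p + snd q - 1))"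
proof (cases "snd p")
  case 0
  then show ?thesis using assms \<delta>_pos wt_mulpos[of 0 p q] by (simp add: hprod_def mon_def)
next
  case (Suc j)
  have "hprod w p q = (\<Sum>k\<le>snd p. if 1 = k then smult (mulcoeff l p q 1) (monom 1 (snd p + snd q - 1)) else 0)"
    unfolding hprod_def
  proof (rule sum.cong)
    fix k assume "k \<in> {..snd p}"
    then have "wt (mulpos l p q k) = w \<longleftrightarrow> int k * \<delta> = 1 * \<delta>" using wt_mulpos[of k p q] assms by auto
    also have "\<dots> \<longleftrightarrow> k = 1" using \<delta>_pos by (subst mult_cancel_right) auto
    finally show "smult (mulcoeff l p q k) (mon w (mulpos l p q k)) =
        (if 1 = k then smult (mulcoeff l p q 1) (monom 1 (snd p + snd q - 1)) else 0)"
      by (auto simp: mon_def mulpos_def)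
  qed simp
  also have "\<dots> = smult (mulcoeff l p q 1) (monom 1 (snd p + snd q - 1))"
    by (subst sum.delta') (use Suc in auto)
  finally show ?thesis by (simp add: mulcoeff_def falling_def)
qed

lemma hprod_above:
  assumes "w > wt p + wt q - \<delta>"
  shows "hprod w p q = mon w (fst p + fst q, snd p + snd q)"
proof -
  have "hprod w p q = (\<Sum>k\<le>snd p. if 0 = k then mon w (fst p + fst q, snd p + snd q) else 0)"
    unfolding hprod_def
  proof (rule sum.cong)
    fix k assume k: "k \<in> {..snd p}"
    have "wt (mulpos l p q k) \<noteq> w" if "k > 0"
    proof -
      have "\<delta> \<le> int k * \<delta>" using \<delta>_pos that by simp
      then show ?thesis using k wt_mulpos[of k p q] assms by auto
    qed
    then show "smult (mulcoeff l p q k) (mon w (mulpos l p q k)) =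
        (if 0 = k then mon w (fst p + fst q, snd p + snd q) else 0)"
      by (auto simp: mon_def mulpos_def mulcoeff_def falling_def)
  qed simp
  then show ?thesis by simp
qed

text \<open>The terms with k = 0 are symmetric in p and q and cancel. For p = (a, j) and q = (b, m)
  the terms with k = 1 leave (j b - m a) / l; times \<rho> l this is \<open>wt q\<close> j -
  \<open>wt p\<close> m, as the \<sigma> parts cancel.\<close>

lemma hprod_comm:
  assumes "w \<ge> wt p + wt q - \<delta>"
  shows "smult (of_int \<rho> * of_nat l) (hprod w p q - hprod w q p) =
    (if w = wt p + wt q - \<delta>
     then pbr (of_int (wt p)) (of_int (wt q)) (monom 1 (snd p)) (monom 1 (snd q) :: 'a::field_char_0 poly)
     else 0)"
proof (cases "w = wt p + wt q - \<delta>")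
  case True
  obtain a j b m where pq: "p = (a, j)" "q = (b, m)" by (metis surj_pair)
  have "pbr (of_int (wt p)) (of_int (wt q)) (monom 1 j) (monom 1 m :: 'a poly) =
     smult (of_int (wt q) * of_nat j - of_int (wt p) * of_nat m) (monom 1 (j + m - 1))"
    by (cases j; cases m) (simp_all add: pbr_def pderiv_monom smult_monom mult_monom diff_monom minus_monom algebra_simps)
  moreover have "of_int (wt q) * of_nat j - of_int (wt p) * of_nat m =
    (of_int \<rho> * of_nat l) * (of_nat j * (of_int b / of_nat l) - of_nat m * (of_int a / of_nat l) :: 'a)"
    using l by (simp add: wt_def pq field_simps)
  moreover have "w = wt q + wt p - \<delta>" using True by simp
  ultimately show ?thesis
    using True unfolding hprod_top[OF True] hprod_top[OF \<open>w = wt q + wt p - \<delta>\<close>]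
    by (simp add: pq smult_diff_left[symmetric] add.commute)
next
  case False
  then show ?thesis using assms by (simp add: hprod_above add.commute)
qed

text \<open>Bilinear extension of \<open>hprod_comm\<close>. Under the bounds u and v, a pair of
  support points reaches weight u + v - \<delta> only if both bounds are attained, and these are the
  pairs that \<open>mon\<close> keeps.\<close>

lemma wcomm_top:
  assumes fin: "wfin P" "wfin Q" and "wle u P" "wle v Q"
  shows "wle (u + v - \<delta>) (wcomm l P Q)"
    and "smult (of_int \<rho> * of_nat l) (hat (u + v - \<delta>) (wcomm l P Q)) =
      pbr (of_int u) (of_int v) (hat u P) (hat v Q)"
proof -
  have bnd: "wt p \<le> u" "wt q \<le> v" if "p \<in> wsupp P" "q \<in> wsupp Q" for p q
    using that wle_wtD[OF assms(3)] wle_wtD[OF assms(4)] by blast+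
  have gen: "smult (of_int \<rho> * of_nat l) (hat w (wcomm l P Q)) =
    (\<Sum>p\<in>wsupp P. \<Sum>q\<in>wsupp Q. smult (P p * Q q) (if w = wt p + wt q - \<delta>
     then pbr (of_int (wt p)) (of_int (wt q)) (monom 1 (snd p)) (monom 1 (snd q)) else 0))"
    if w: "w \<ge> u + v - \<delta>" for w
  proof -
    have "hat w (wcomm l P Q) = (\<Sum>p\<in>wsupp P. \<Sum>q\<in>wsupp Q. smult (P p * Q q) (hprod w p q))
        - (\<Sum>p\<in>wsupp Q. \<Sum>q\<in>wsupp P. smult (Q p * P q) (hprod w p q))"
      by (simp add: wcomm_eq_diff hat_diff hat_wmul wfin_wmul fin)
    also have "(\<Sum>p\<in>wsupp Q. \<Sum>q\<in>wsupp P. smult (Q p * P q) (hprod w p q)) =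
       (\<Sum>p\<in>wsupp P. \<Sum>q\<in>wsupp Q. smult (P p * Q q) (hprod w q p))"
      by (subst sum.swap) (simp add: mult.commute)
    finally have "hat w (wcomm l P Q) =
        (\<Sum>p\<in>wsupp P. \<Sum>q\<in>wsupp Q. smult (P p * Q q) (hprod w p q - hprod w q p))"
      by (simp add: sum_subtractf smult_diff_right)
    then have "smult (of_int \<rho> * of_nat l) (hat w (wcomm l P Q)) =
        (\<Sum>p\<in>wsupp P. \<Sum>q\<in>wsupp Q. smult (P p * Q q) (smult (of_int \<rho> * of_nat l) (hprod w p q - hprod w q p)))"
      by (simp only: smult_sum_right smult_smult mult.commute)
    also have "\<dots> = (\<Sum>p\<in>wsupp P. \<Sum>q\<in>wsupp Q. smult (P p * Q q) (if w = wt p + wt q - \<delta>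
     then pbr (of_int (wt p)) (of_int (wt q)) (monom 1 (snd p)) (monom 1 (snd q)) else 0))"
    proof (intro sum.cong refl, goal_cases)
      case (1 p q)
      have "wt p + wt q - \<delta> \<le> w" using bnd[OF 1] w by linarith
      then show ?case by (simp only: hprod_comm)
    qed
    finally show ?thesis .
  qed
  show "wle (u + v - \<delta>) (wcomm l P Q)"
    unfolding wle_def
  proof (intro allI impI)
    fix x assume x: "u + v - \<delta> < wt x"
    have "smult (of_int \<rho> * of_nat l) (hat (wt x) (wcomm l P Q)) = 0"
    proof (subst gen)
      have "wt x \<noteq> wt p + wt q - \<delta>" if "p \<in> wsupp P" "q \<in> wsupp Q" for p q
        using bnd[OF that] x by linarith
      then show "(\<Sum>p\<in>wsupp P. \<Sum>q\<in>wsupp Q. smult (P p * Q q) (if wt x = wt p + wt q - \<delta>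
        then pbr (of_int (wt p)) (of_int (wt q)) (monom 1 (snd p)) (monom 1 (snd q)) else 0)) = 0"
        by (intro sum.neutral ballI) simp
    qed (use x in simp)
    then have "hat (wt x) (wcomm l P Q) = 0" using l \<rho> by simp
    then show "wcomm l P Q x = 0" using hat_eq_0_iff[OF wfin_wcomm[OF fin]] by blast
  qed
  have "pbr (of_int u) (of_int v) (hat u P) (hat v Q) = (\<Sum>p\<in>wsupp P. \<Sum>q\<in>wsupp Q.
      smult (P p * Q q) (pbr (of_int u) (of_int v) (mon u p) (mon v q)))"
    by (simp add: hat_def pbr_sum pbr_smult)
  also have "\<dots> = (\<Sum>p\<in>wsupp P. \<Sum>q\<in>wsupp Q. smult (P p * Q q) (if u + v - \<delta> = wt p + wt q - \<delta>
     then pbr (of_int (wt p)) (of_int (wt q)) (monom 1 (snd p)) (monom 1 (snd q)) else 0))"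
  proof (intro sum.cong refl, goal_cases)
    case (1 p q)
    then show ?case using bnd[of p q] by (auto simp: mon_def)
  qed
  finally show "smult (of_int \<rho> * of_nat l) (hat (u + v - \<delta>) (wcomm l P Q)) =
      pbr (of_int u) (of_int v) (hat u P) (hat v Q)"
    by (simp add: gen)
qed

section \<open>Growth of the algebra generated by P and Q\<close>

lemma wle_wone: "wle 0 wone"
  by (auto simp: wle_def wone_def wt_def)

lemma wle_monom_PQ:
  assumes fin: "wfin P" "wfin Q" and P: "wle u P" and Q: "wle w Q"
  shows "wle (int i * u + int j * w) (monom_PQ l P Q i j)"
proof (induction i)
  case 0
  show ?case unfolding monom_PQ_def
  proof (induction j)
    case (Suc j)
    have "wle (w + (int 0 * u + int j * w)) (wmul l Q ((wmul l Q ^^ j) wone))"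
      by (rule wle_wmul) (use Suc fin Q in \<open>simp_all add: wfin_funpow_wmul wfin_wone\<close>)
    then show ?case by (simp add: algebra_simps)
  qed (simp add: wle_wone)
next
  case (Suc i)
  have "wle (u + (int i * u + int j * w)) (wmul l P (monom_PQ l P Q i j))"
    by (rule wle_wmul) (use Suc fin P in \<open>simp_all add: wfin_monom_PQ\<close>)
  then show ?case by (simp add: algebra_simps monom_PQ_def)
qed

lemma wfin_funpow_wcomm: "wfin P \<Longrightarrow> wfin G \<Longrightarrow> wfin ((wcomm l P ^^ k) G)"
  by (induction k) (simp_all add: wfin_wcomm)

lemma wle_funpow_wcomm:
  assumes "wfin P" "wfin G" "wle u P" "wle v G"
  shows "wle (v + int k * (u - \<delta>)) ((wcomm l P ^^ k) G)"
proof (induction k)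
  case (Suc k)
  have "wle (u + (v + int k * (u - \<delta>)) - \<delta>) (wcomm l P ((wcomm l P ^^ k) G))"
    by (rule wcomm_top(1)) (use assms Suc in \<open>simp_all add: wfin_funpow_wcomm\<close>)
  then show ?case by (simp add: algebra_simps)
qed (use assms in simp)

text \<open>A commutator with P or Q changes the weight bound by u - \<delta> or w - \<delta>. After
  at most N of each, a nonzero constant is reached, so the final bound is at least 0.\<close>

lemma wle_wcombD:
  assumes fin: "wfin P" "wfin Q" and QP: "wcomm l Q P = wone"
    and P: "wle u P" "u \<ge> 0" and Q: "wle w Q" "w \<ge> 0"
    and c: "y0 \<in> {..N} \<times> {..N}" "c y0 \<noteq> 0"
    and v: "wle v (wcomb l P Q N c 0 0)"
  shows "- (int N * (u + w)) \<le> v"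
proof -
  obtain i j d where ij: "i \<le> N" "j \<le> N" and d: "d \<noteq> 0"
    and eq: "(wcomm l Q ^^ i) ((wcomm l P ^^ j) (wcomb l P Q N c 0 0)) = (\<lambda>x. d * wone x)"
    using iterated_wcomm_wcomb[OF l fin QP c(1), of c] c(2) by blast
  have "wle (v + int j * (u - \<delta>) + int i * (w - \<delta>)) (\<lambda>x. d * wone x)"
    unfolding eq[symmetric]
    by (intro wle_funpow_wcomm wfin_funpow_wcomm wfin_wcomb fin P Q v)
  then have "0 \<le> v + int j * (u - \<delta>) + int i * (w - \<delta>)"
    using d wle_wtD[of _ "\<lambda>x. d * wone x" "(0, 0)"] by (simp add: wsupp_def wone_def wt_def)
  moreover have "int k * (t - \<delta>) \<le> int N * t" if "k \<le> N" "t \<ge> 0" for k t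
  proof -
    have "int k * (t - \<delta>) \<le> int k * t" using \<delta>_pos by (intro mult_left_mono) simp_all
    also have "\<dots> \<le> int N * t" using that by (intro mult_right_mono) simp_all
    finally show ?thesis .
  qed
  from this[OF ij(2) P(2)] this[OF ij(1) Q(2)]
  have "int j * (u - \<delta>) \<le> int N * u" "int i * (w - \<delta>) \<le> int N * w" .
  ultimately show ?thesis by (simp add: algebra_simps)
qed

lemma exists_top_weight:
  assumes "wfin G" "G x \<noteq> 0"
  obtains v where "wle v G" "hat v G \<noteq> 0"
proof -
  define v where "v = Max (wt ` wsupp G)"
  have fin: "finite (wt ` wsupp G)" and ne: "wt ` wsupp G \<noteq> {}"
    using assms unfolding wfin_def wsupp_def by blast+
  have "wle v G"
    unfolding wle_def
  proof (intro allI impI, rule ccontr)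
    fix x assume "v < wt x" "G x \<noteq> 0"
    then show False using Max_ge[OF fin, of "wt x"] by (auto simp: v_def wsupp_def)
  qed
  moreover have "hat v G \<noteq> 0"
  proof
    obtain y where "y \<in> wsupp G" "wt y = v" using Max_in[OF fin ne] unfolding v_def by (metis imageE)
    moreover assume "hat v G = 0"
    ultimately show False using hat_eq_0_iff[OF assms(1), of v] unfolding wsupp_def by blast
  qed
  ultimately show ?thesis using that by blast
qed

lemma hat_neq_0_le:
  assumes "wle u G" "hat v G \<noteq> 0"
  shows "v \<le> u"
proof (rule ccontr)
  assume "\<not> v \<le> u"
  then have "smult (G x) (mon v x) = 0" if "x \<in> wsupp G" for x
    using wle_wtD[OF assms(1) that] by (auto simp: mon_def)
  then have "hat v G = 0" unfolding hat_def by (rule sum.neutral[OF ballI])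
  then show False using assms by simp
qed

lemma exists_nondegenerate:
  fixes P Q :: "'a::field_char_0 wel"
  assumes fin: "wfin P" "wfin Q" and QP: "wcomm l Q P = wone"
    and P: "wle u P" "u > 0" and Q: "wle w Q" "w > 0" and p: "hat u P \<noteq> 0"
  obtains G v k where "wfin G" "wle v G" "pbr (of_int u) (of_int v) (hat u P) (hat v G) \<noteq> 0"
    "(wcomm l P ^^ k) G = (\<lambda>_. 0)"
proof -
  obtain b p0 where b: "hat u P = [:0, 1:] ^ b * p0" "\<not> [:0, 1:] dvd p0" "coeff (hat u P) b \<noteq> 0"
    by (rule order_0_decompose[OF p])
  obtain a where a: "wt (a, b) = u" using coeff_hat_neq_0D[OF fin(1) b(3)] by blast
  \<comment> \<open>With this N the number of weights is 2B + 1 = N^2 + 1, below the number (N+1)^2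
    of monomials.\<close>
  define N where "N = nat (2 * (u + w))"
  define B where "B = int N * (u + w)"
  \<comment> \<open>The point (v/u)(a, b), which is where the lowest exponent in weight v must lie
    if the bracket with p vanishes. The roundings matter only for weights where that point is not in
    the lattice; there the equation is merely an extra one.\<close>
  define pos where "pos v = (v * a div u, nat (v * int b div u))" for v
  define I where "I = {..N} \<times> {..N}"
  have "card {-B..B} < card I"
  proof -
    have "int N = 2 * (u + w)" using P Q by (simp add: N_def)
    then have "int (card I) = (2 * (u + w) + 1) * (2 * (u + w) + 1)" "B = 2 * (u + w) * (u + w)"
      by (simp_all add: I_def B_def card_cartesian_product algebra_simps)
    moreover from this have "B \<ge> 0" using P Q by simp
    ultimately have "int (card {-B..B}) < int (card I)" using P Q by (simp add: algebra_simps)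
    then show ?thesis by (simp only: of_nat_less_iff)
  qed
  then obtain c where "\<exists>y\<in>I. c y \<noteq> 0"
    and c0: "\<And>v. v \<in> {-B..B} \<Longrightarrow> (\<Sum>y\<in>I. c y * monom_PQ l P Q (fst y) (snd y) (pos v)) = 0"
    using homogeneous_system_nontrivial[of "{-B..B}" I "\<lambda>v y. monom_PQ l P Q (fst y) (snd y) (pos v)"]
    unfolding I_def by blast
  then obtain y0 where y0: "y0 \<in> {..N} \<times> {..N}" "c y0 \<noteq> 0" unfolding I_def by blast
  define G where "G = wcomb l P Q N c 0 0"
  have G: "wfin G" by (simp add: G_def wfin_wcomb fin)
  have low: "- B \<le> v" if "wle v G" for v
    using wle_wcombD[OF fin QP P(1) _ Q(1) _ y0(1), of c v] y0(2) that P Q by (simp add: B_def G_def)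
  have up: "wle B G"
    unfolding wle_def
  proof (intro allI impI)
    fix x assume x: "B < wt x"
    have "monom_PQ l P Q (fst y) (snd y) x = 0" if "y \<in> I" for y
    proof -
      have "int (fst y) * u + int (snd y) * w \<le> B"
        using that P Q by (auto simp: I_def B_def algebra_simps intro!: add_mono mult_left_mono)
      then have "wle B (monom_PQ l P Q (fst y) (snd y))"
        using wle_monom_PQ[OF fin P(1) Q(1)] by (rule wle_mono[rotated])
      then show ?thesis using x unfolding wle_def by blast
    qed
    then show "G x = 0" by (simp add: G_def wcomb_def I_def)
  qed
  \<comment> \<open>A nontrivial combination is nonzero because 0 would satisfy every weight bound,
    also one below -B.\<close>
  have "\<exists>x. G x \<noteq> 0"
  proof (rule ccontr)
    assume "\<nexists>x. G x \<noteq> 0"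
    then have "wle (- B - 1) G" by (simp add: wle_def)
    then show False using low by fastforce
  qed
  then obtain v where v: "wle v G" "hat v G \<noteq> 0" using exists_top_weight[OF G] by blast
  have vB: "v \<in> {-B..B}" using low[OF v(1)] hat_neq_0_le[OF up v(2)] by simp
  have "pbr (of_int u) (of_int v) (hat u P) (hat v G) \<noteq> 0"
  proof
    assume br: "pbr (of_int u) (of_int v) (hat u P) (hat v G) = 0"
    obtain m g0 where m: "hat v G = [:0, 1:] ^ m * g0" "\<not> [:0, 1:] dvd g0" "coeff (hat v G) m \<noteq> 0"
      by (rule order_0_decompose[OF v(2)])
    \<comment> \<open>The prime is y, at which p has order b and the leading part of G has order
      m.\<close>
    have X: "prime_elem [:0, 1 :: 'a:]" by (rule prime_elem_linear_field_poly) simp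
    have X': "\<not> [:0, 1 :: 'a:] dvd pderiv [:0, 1:]" using X by (simp add: pderiv_pCons prime_elem_def flip: one_pCons)
    have "of_int u * of_nat m = (of_int v * of_nat b :: 'a)"
      by (rule pbr_multiplicity[OF X X' b(2) m(2)]) (use br in \<open>simp flip: b(1) m(1)\<close>)
    then have "of_int (u * int m) = (of_int (v * int b) :: 'a)" by simp
    then have um: "u * int m = v * int b" by (simp only: of_int_eq_iff)
    obtain i where i: "wt (i, m) = v" "G (i, m) \<noteq> 0"
      using coeff_hat_neq_0D[OF G m(3)] by blast
    \<comment> \<open>The weights turn u m = v b into u i = v a, so the divisions in
      \<open>pos\<close> are exact and give (i, m).\<close>
    have "\<rho> * (u * i) = u * v - \<sigma> * int l * (u * int m)"
      using i(1)[symmetric] by (simp add: wt_def algebra_simps)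
    also have "\<dots> = v * (u - \<sigma> * int l * int b)" by (simp add: um algebra_simps)
    also have "\<dots> = \<rho> * (v * a)" using a[symmetric] by (simp add: wt_def algebra_simps)
    finally have "u * i = v * a" using \<rho> by simp
    then have "pos v = (i, m)" using um P(2) by (simp add: pos_def flip: \<open>u * i = v * a\<close> um)
    then have "G (i, m) = 0" using c0[OF vB] by (simp add: G_def wcomb_def I_def)
    then show False using i by simp
  qed
  moreover have PQ: "wcomm l P Q = (\<lambda>x. (-1) * wone x)"
    using QP by (auto simp: wcomm_def fun_eq_iff algebra_simps)
  have "(wcomm l P ^^ Suc N) G = (\<lambda>_. 0)"
    unfolding G_def by (rule funpow_wcomm_wcomb_eq_0[OF l fin PQ])
  ultimately show ?thesis using that G v by blast
qed

lemma exists_bracket_chain: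
  fixes P Q :: "'a::field_char_0 wel"
  assumes fin: "wfin P" "wfin Q" and QP: "wcomm l Q P = wone"
    and P: "wle u P" "u > 0" and Q: "wle w Q" "w > 0" and p: "hat u P \<noteq> 0"
  obtains G E v where "wfin G" "wfin E" "hat (v + u - \<delta>) E \<noteq> 0"
    "pbr (of_int u) (of_int v) (hat u P) (hat v G) = smult (of_int \<rho> * of_nat l) (hat (v + u - \<delta>) E)"
    "pbr (of_int u) (of_int (v + u - \<delta>)) (hat u P) (hat (v + u - \<delta>) E) = 0"
proof -
  obtain G v K where G: "wfin G" and v: "wle v G"
    and nz: "pbr (of_int u) (of_int v) (hat u P) (hat v G) \<noteq> 0" and K: "(wcomm l P ^^ K) G = (\<lambda>_. 0)"
    using exists_nondegenerate[OF assms] .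
  define H where "H k = (wcomm l P ^^ k) G" for k
  define V where "V k = v + int k * (u - \<delta>)" for k
  have H: "wfin (H k)" "wle (V k) (H k)" for k
    using wfin_funpow_wcomm[OF fin(1) G] wle_funpow_wcomm[OF fin(1) G P(1) v] by (simp_all add: H_def V_def)
  have VS: "V (Suc k) = V k + u - \<delta>" for k by (simp add: V_def algebra_simps)
  have step: "smult (of_int \<rho> * of_nat l) (hat (V (Suc k)) (H (Suc k))) =
      pbr (of_int u) (of_int (V k)) (hat u P) (hat (V k) (H k))" for k
    using wcomm_top(2)[OF fin(1) H(1) P(1) H(2), of k] by (simp add: VS H_def add.commute)
  \<comment> \<open>The first index where the part at the expected weight vanishes, possibly before
    the iterated commutator does. Nondegeneracy of G gives n at least 2, and the indices n - 2 and n
    - 1 supply g and e.\<close>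
  define n where "n = (LEAST k. hat (V k) (H k) = 0)"
  have "hat (V K) (H K) = 0" by (simp add: H_def K hat_def wsupp_def)
  then have n: "hat (V n) (H n) = 0" unfolding n_def by (rule LeastI)
  have less: "hat (V k) (H k) \<noteq> 0" if "k < n" for k using not_less_Least[of k] that by (auto simp: n_def)
  have "hat (V 0) (H 0) \<noteq> 0" "hat (V 1) (H 1) \<noteq> 0"
    using nz step[of 0] by (auto simp: V_def H_def)
  then have "n \<noteq> 0" "n \<noteq> 1" using n by metis+
  then obtain m where m: "n = Suc (Suc m)" by (metis One_nat_def not0_implies_Suc)
  show ?thesis
  proof (rule that[of "H m" "H (Suc m)" "V m"])
    show "hat (V m + u - \<delta>) (H (Suc m)) \<noteq> 0" using less[of "Suc m"] m by (simp add: VS)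
    show "pbr (of_int u) (of_int (V m)) (hat u P) (hat (V m) (H m)) =
      smult (of_int \<rho> * of_nat l) (hat (V m + u - \<delta>) (H (Suc m)))"
      using step[of m] by (simp add: VS)
    show "pbr (of_int u) (of_int (V m + u - \<delta>)) (hat u P) (hat (V m + u - \<delta>) (H (Suc m))) = 0"
      using step[of "Suc m"] n m by (simp add: VS)
  qed (rule H)+
qed

text \<open>The quotient F = G P / [P, G] may involve exponents not of the form (i/l, j);
  discarding those does not affect the equation, since they form a separate class modulo the lattice.\<close>

lemma exists_bracket_fixing:
  fixes P Q :: "'a::field_char_0 wel"
  assumes fin: "wfin P" "wfin Q" and QP: "wcomm l Q P = wone"
    and P: "wle u P" "u > 0" and Q: "wle w Q" "w > 0" and p: "hat u P \<noteq> 0"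
  obtains F where "wfin F" "\<forall>x. wt x \<noteq> \<delta> \<longrightarrow> F x = 0"
    "pbr (of_int u) (of_int \<delta>) (hat u P) (hat \<delta> F) = smult (of_int \<rho> * of_nat l) (hat u P)"
proof -
  obtain G E v where GE: "wfin G" "wfin E" and e: "hat (v + u - \<delta>) E \<noteq> 0"
    and pg: "pbr (of_int u) (of_int v) (hat u P) (hat v G) = smult (of_int \<rho> * of_nat l) (hat (v + u - \<delta>) E)"
    and pe: "pbr (of_int u) (of_int (v + u - \<delta>)) (hat u P) (hat (v + u - \<delta>) E) = 0"
    using exists_bracket_chain[OF assms] .
  define p where "p = hat u P"
  define g where "g = hat v G"
  define e where "e = hat (v + u - \<delta>) E"
  define r where "r = (of_int \<rho> * of_nat l :: 'a)"
  have nz: "p \<noteq> 0" "e \<noteq> 0" using assms e by (simp_all add: p_def e_def)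
  have ps: "pbr (of_int u) (of_int (v + u)) p (g * p) = smult r (p * e)"
    using pbr_mult[of "of_int u" "of_int v" "of_int u" p g p] pg
    by (simp add: pbr_self p_def g_def e_def r_def mult.commute)
  have "e dvd g * p"
    using bracket_quotient_polynomial[of u \<delta> p e "v + u - \<delta>" "g * p" r] P \<delta>_pos nz pe ps
    by (simp add: p_def e_def)
  then obtain f where f: "g * p = e * f" by (elim dvdE)
  define F where "F x = (if wt x = \<delta> then coeff f (snd x) else 0)" for x
  have "wsupp F \<subseteq> {x. wt x = \<delta> \<and> snd x \<le> degree f}"
    by (auto simp: wsupp_def F_def le_degree split: if_splits)
  moreover have "finite {x. wt x = \<delta> \<and> snd x \<le> degree f}"
  proof (rule finite_imageD)
    show "finite (snd ` {x. wt x = \<delta> \<and> snd x \<le> degree f})"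
      by (rule finite_subset[of _ "{..degree f}"]) auto
    show "inj_on snd {x. wt x = \<delta> \<and> snd x \<le> degree f}"
    proof (rule inj_onI)
      fix x y assume *: "x \<in> {x. wt x = \<delta> \<and> snd x \<le> degree f}"
        "y \<in> {x. wt x = \<delta> \<and> snd x \<le> degree f}" "snd x = snd y"
      then have "wt (fst x, snd x) = wt (fst y, snd x)" by (simp add: wt_def)
      then have "fst x = fst y" by (rule wt_inj)
      then show "x = y" using * by (simp add: prod_eq_iff)
    qed
  qed
  ultimately have F: "wfin F" unfolding wfin_def by (rule finite_subset)
  have eF: "e * hat \<delta> F = g * p"
  proof (rule poly_eqI)
    fix n
    show "coeff (e * hat \<delta> F) n = coeff (g * p) n"
    \<comment> \<open>If y^n occurs at a lattice point of weight v + u, each k in the support of e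
      puts y^(n-k) at a lattice point of weight \<delta>, where F agrees with f. Otherwise both
      coefficients vanish.\<close>
    proof (cases "\<exists>i. wt (i, n) = v + u")
      case True
      then obtain i where i: "wt (i, n) = v + u" by blast
      have "coeff e k * coeff (hat \<delta> F) (n - k) = coeff e k * coeff f (n - k)" if "k \<le> n" for k
      proof (cases "coeff e k = 0")
        case False
        then obtain j where "wt (j, k) = v + u - \<delta>" using coeff_hat_neq_0D[OF GE(2)] unfolding e_def by blast
        then have "wt (i - j, n - k) = \<delta>" using i that by (simp add: wt_def of_nat_diff algebra_simps)
        then show ?thesis by (simp add: coeff_hat[OF F] F_def)
      qed simp
      then show ?thesis unfolding f coeff_mult by (intro sum.cong) auto
    next
      case False
      have "coeff e k * coeff (hat \<delta> F) (n - k) = 0" if "k \<le> n" for k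
      proof (rule ccontr)
        assume "coeff e k * coeff (hat \<delta> F) (n - k) \<noteq> 0"
        then have "coeff e k \<noteq> 0" "coeff (hat \<delta> F) (n - k) \<noteq> 0" by auto
        then obtain i j where "wt (i, k) = v + u - \<delta>" "wt (j, n - k) = \<delta>"
          using coeff_hat_neq_0D[OF GE(2)] coeff_hat_neq_0D[OF F] unfolding e_def by blast
        then have "wt (i + j, n) = v + u" using that by (simp add: wt_def of_nat_diff algebra_simps)
        then show False using False by blast
      qed
      moreover have "coeff g k * coeff p (n - k) = 0" if "k \<le> n" for k
      proof (rule ccontr)
        assume "coeff g k * coeff p (n - k) \<noteq> 0"
        then have "coeff g k \<noteq> 0" "coeff p (n - k) \<noteq> 0" by auto
        then obtain i j where "wt (i, k) = v" "wt (j, n - k) = u"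
          using coeff_hat_neq_0D[OF GE(1)] coeff_hat_neq_0D[OF fin(1)] unfolding g_def p_def by blast
        then have "wt (i + j, n) = v + u" using that by (simp add: wt_def of_nat_diff algebra_simps)
        then show False using False by blast
      qed
      ultimately show ?thesis unfolding coeff_mult by (intro sum.cong refl) (simp only: atMost_iff)
    qed
  qed
  \<comment> \<open>As {p, e} = 0, the left side is {p, e F} = {p, g p}.\<close>
  have "e * pbr (of_int u) (of_int \<delta>) p (hat \<delta> F) = e * smult r p"
    using pbr_mult[of "of_int u" "of_int (v + u - \<delta>)" "of_int \<delta>" p e "hat \<delta> F"] pe ps
    by (simp add: eF e_def[symmetric] p_def[symmetric] mult.commute)
  then have "pbr (of_int u) (of_int \<delta>) p (hat \<delta> F) = smult r p" using nz by (simp only: mult_cancel_left) simp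
  then show ?thesis using that[of F] F by (simp add: F_def p_def r_def)
qed

section \<open>Leading terms, brackets and starting points\<close>

lemma vdeg_eq_wt: "vdeg l \<rho> \<sigma> x = of_int (wt x) / of_nat l"
  using l by (simp add: vdeg_def wt_def field_simps)

lemma wt_top_exists:
  assumes "wfin G" "hat v G \<noteq> 0"
  obtains x where "wt x = v" "G x \<noteq> 0"
  using assms hat_eq_0_iff by blast

lemma vval_eq:
  assumes fin: "wfin G" and v: "wle v G" "hat v G \<noteq> 0"
  shows "vval l \<rho> \<sigma> G = of_int v / of_nat l"
  unfolding vval_def
proof (rule Max_eqI)
  show "finite (vdeg l \<rho> \<sigma> ` wsupp G)" using fin by (simp add: wfin_def)
  show "y \<le> of_int v / of_nat l" if "y \<in> vdeg l \<rho> \<sigma> ` wsupp G" for y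
    using that wle_wtD[OF v(1)] by (auto simp: vdeg_eq_wt divide_right_mono)
  obtain x where "wt x = v" "G x \<noteq> 0" using wt_top_exists[OF fin v(2)] .
  then show "of_int v / of_nat l \<in> vdeg l \<rho> \<sigma> ` wsupp G"
    by (intro image_eqI[of _ _ x]) (simp_all add: vdeg_eq_wt wsupp_def)
qed

lemma lead_eq:
  assumes "wfin G" "wle v G" "hat v G \<noteq> 0"
  shows "lead l \<rho> \<sigma> G = (\<lambda>x. if wt x = v then G x else 0)"
  using l by (simp add: lead_def vval_eq[OF assms] vdeg_eq_wt fun_eq_iff)

lemma lead_eqI:
  assumes G: "wfin G" "wle v G" "hat v G \<noteq> 0" and H: "wfin H" "wle v H"
    and eq: "hat v H = smult c (hat v G)" "c \<noteq> 0"
  shows "lead l \<rho> \<sigma> H = (\<lambda>x. c * lead l \<rho> \<sigma> G x)"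
proof -
  have nz: "hat v H \<noteq> 0" using eq G by simp
  have "H (i, j) = c * G (i, j)" if "wt (i, j) = v" for i j
    using coeff_hat[OF H(1) that] coeff_hat[OF G(1) that] eq by simp
  then show ?thesis by (auto simp: lead_eq[OF G] lead_eq[OF H nz] fun_eq_iff)
qed

text \<open>The threshold in \<open>bracket\<close> is (u + v - \<delta>) / l, so a nonzero part at
  that weight rules out the zero branch.\<close>

lemma bracket_eq_lead:
  assumes P: "wfin P" "wle u P" "hat u P \<noteq> 0" and Q: "wfin Q" "wle v Q" "hat v Q \<noteq> 0"
    and nz: "hat (u + v - \<delta>) (wcomm l P Q) \<noteq> 0"
  shows "bracket l \<rho> \<sigma> P Q = lead l \<rho> \<sigma> (wcomm l P Q)"
proof -
  have "wle (u + v - \<delta>) (wcomm l P Q)" by (rule wcomm_top(1)[OF P(1) Q(1) P(2) Q(2)])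
  then have "vval l \<rho> \<sigma> (wcomm l P Q) = of_int (u + v - \<delta>) / of_nat l"
    by (rule vval_eq[OF wfin_wcomm[OF P(1) Q(1)] _ nz])
  moreover have "of_int (u + v - \<delta>) / of_nat l = (of_int u / of_nat l + of_int v / of_nat l - of_int (\<rho> + \<sigma>) :: rat)"
    using l by (simp add: \<delta>_def field_simps)
  moreover have "wcomm l P Q \<noteq> (\<lambda>_. 0)"
  proof
    assume "wcomm l P Q = (\<lambda>_. 0)"
    then show False using nz by (simp add: hat_def)
  qed
  ultimately show ?thesis by (simp add: bracket_def vval_eq[OF P] vval_eq[OF Q])
qed

lemma lead_neq_0:
  assumes "wfin G" "wle v G" "hat v G \<noteq> 0"
  shows "lead l \<rho> \<sigma> G \<noteq> (\<lambda>_. 0)"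
proof
  obtain x where "wt x = v" "G x \<noteq> 0" using wt_top_exists[OF assms(1,3)] .
  moreover assume "lead l \<rho> \<sigma> G = (\<lambda>_. 0)"
  then have "lead l \<rho> \<sigma> G x = 0" by (rule fun_cong)
  ultimately show False by (simp add: lead_eq[OF assms])
qed

text \<open>With D = i - l j one has \<rho> D = \<open>wt\<close> - \<delta> j, so at fixed weight
  the largest value of D occurs at the smallest Y-exponent.\<close>

lemma st_eq:
  assumes G: "wfin G" "wle v G" "hat v G \<noteq> 0"
    and ab: "wt (a, b) = v" "G (a, b) \<noteq> 0" and min: "\<forall>i<b. coeff (hat v G) i = 0"
  shows "st l \<rho> \<sigma> G = (a, b)"
proof -
  define S where "S = wsupp (lead l \<rho> \<sigma> G)"
  define D where "D x = fst x - int l * int (snd x)" for x :: "int \<times> nat"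
  have D: "\<rho> * D x = wt x - \<delta> * int (snd x)" for x
    by (simp add: D_def wt_def \<delta>_def algebra_simps)
  have vdeg: "vdeg l 1 (-1) x = of_int (D x) / of_nat l" for x
    using l by (simp add: vdeg_def D_def field_simps)
  have vdeg_le: "vdeg l 1 (-1) x \<le> vdeg l 1 (-1) y \<longleftrightarrow> D x \<le> D y" for x y
    using l by (simp add: vdeg divide_le_cancel)
  have S: "x \<in> S \<longleftrightarrow> wt x = v \<and> G x \<noteq> 0" for x
    by (auto simp: S_def lead_eq[OF G] wsupp_def)
  have le: "D x \<le> D y \<longleftrightarrow> snd y \<le> snd x" if "x \<in> S" "y \<in> S" for x y
  proof -
    have "D x \<le> D y \<longleftrightarrow> \<rho> * D x \<le> \<rho> * D y" using \<rho> by simp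
    also have "\<dots> \<longleftrightarrow> \<delta> * int (snd y) \<le> \<delta> * int (snd x)" using that by (simp add: D S)
    also have "\<dots> \<longleftrightarrow> snd y \<le> snd x" using \<delta>_pos by simp
    finally show ?thesis .
  qed
  have low: "b \<le> snd x" if "x \<in> S" for x
  proof (rule ccontr)
    assume "\<not> b \<le> snd x"
    then have "coeff (hat v G) (snd x) = 0" using min by simp
    moreover have "wt (fst x, snd x) = v" "G (fst x, snd x) \<noteq> 0" using that by (simp_all add: S)
    ultimately show False using coeff_hat[OF G(1)] by metis
  qed
  have uniq: "x = y" if "x \<in> S" "y \<in> S" "snd x = snd y" for x y
  proof -
    have "wt (fst x, snd x) = wt (fst y, snd x)" using that by (simp add: S wt_def)
    then show ?thesis using wt_inj that(3) by (metis prod.collapse)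
  qed
  have abS: "(a, b) \<in> S" using ab by (simp add: S)
  show ?thesis
    unfolding st_def S_def[symmetric] Let_def
  proof (rule the_equality)
    show "(a, b) \<in> S \<and> (\<forall>q\<in>S. vdeg l 1 (- 1) q \<le> vdeg l 1 (- 1) (a, b)) \<and>
      (\<forall>q\<in>S. vdeg l 1 (- 1) q = vdeg l 1 (- 1) (a, b) \<longrightarrow> fst q \<le> fst (a, b))"
    proof (intro conjI ballI impI)
      fix q assume q: "q \<in> S"
      show "vdeg l 1 (- 1) q \<le> vdeg l 1 (- 1) (a, b)" using q abS low by (simp add: vdeg_le le)
      assume "vdeg l 1 (- 1) q = vdeg l 1 (- 1) (a, b)"
      then have "D (a, b) \<le> D q" using vdeg_le[of "(a, b)" q] by simp
      then have "q = (a, b)" using le[OF abS q] low[OF q] by (intro uniq q abS) simp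
      then show "fst q \<le> fst (a, b)" by simp
    qed (rule abS)
    fix x assume "x \<in> S \<and> (\<forall>q\<in>S. vdeg l 1 (- 1) q \<le> vdeg l 1 (- 1) x) \<and>
      (\<forall>q\<in>S. vdeg l 1 (- 1) q = vdeg l 1 (- 1) x \<longrightarrow> fst q \<le> fst x)"
    then have x: "x \<in> S" "D (a, b) \<le> D x" using abS by (auto simp: vdeg_le)
    then have "snd x = b" using le[OF abS x(1)] low[OF x(1)] by simp
    then show "x = (a, b)" using uniq[OF x(1) abS] by simp
  qed
qed

text \<open>A starting point on the diagonal means u = \<delta> b, where b > 0 because u > 0: the
  case excluded by \<open>pbr_neq_if_diagonal\<close>.\<close>

lemma vdeg_st_neq_0:
  assumes P: "wfin P" "wle u P" "hat u P \<noteq> 0" and u: "u > 0"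
    and f: "pbr (of_int u) (of_int \<delta>) (hat u P) f = smult (of_int \<rho> * of_nat l) (hat u P)"
  shows "vdeg l 1 (-1) (st l \<rho> \<sigma> P) \<noteq> 0"
proof
  obtain b p0 where b: "hat u P = [:0, 1:] ^ b * p0" "\<not> [:0, 1:] dvd p0" "coeff (hat u P) b \<noteq> 0"
    "\<forall>i<b. coeff (hat u P) i = 0"
    by (rule order_0_decompose[OF P(3)])
  obtain a where a: "wt (a, b) = u" "P (a, b) \<noteq> 0" using coeff_hat_neq_0D[OF P(1) b(3)] by blast
  assume "vdeg l 1 (-1) (st l \<rho> \<sigma> P) = 0"
  then have "(of_int a :: rat) = of_int (int l * int b)"
    using l by (simp add: st_eq[OF P a b(4)] vdeg_def field_simps)
  then have "a = int l * int b" by (simp only: of_int_eq_iff)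
  then have ub: "u = \<delta> * int b" using a by (simp add: wt_def \<delta>_def algebra_simps)
  then have "b > 0" using u by (cases b) auto
  then have "pbr (of_int \<delta> * of_nat b) (of_int \<delta>) (hat u P) f \<noteq> smult (of_int \<rho> * of_nat l) (hat u P)"
    by (rule pbr_neq_if_diagonal[OF b(1,2)]) (use \<delta>_pos \<rho> l in auto)
  then show False using f by (simp add: ub)
qed

end

theorem theorem3p5:
  fixes P Q :: "'a::field_char_0 wel" and l :: nat and \<rho> \<sigma> :: int
  assumes "l \<ge> 1"
    and "wfin P" and "wfin Q"
    and "(\<rho>, \<sigma>) \<in> Vset" and "\<sigma> \<le> 0"
    and "wcomm l Q P = wone"
    and "vval l \<rho> \<sigma> P > 0" and "vval l \<rho> \<sigma> Q > 0"
    and "bracket l \<rho> \<sigma> P Q = (\<lambda>_. 0)"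
    and "vval l \<rho> \<sigma> P / vval l \<rho> \<sigma> Q \<notin> range of_nat"
    and "vval l \<rho> \<sigma> Q / vval l \<rho> \<sigma> P \<notin> range of_nat"
  shows "((\<rho>, \<sigma>) \<notin> Val l P \<longrightarrow> vval l 1 (-1) (lead l \<rho> \<sigma> P) \<noteq> 0)
    \<and> vdeg l 1 (-1) (st l \<rho> \<sigma> P) \<noteq> 0
    \<and> (\<exists>F. wfin F \<and> homog l \<rho> \<sigma> F
          \<and> bracket l \<rho> \<sigma> P F = lead l \<rho> \<sigma> P
          \<and> bracket l \<rho> \<sigma> Q F = (\<lambda>p. of_rat (vval l \<rho> \<sigma> Q / vval l \<rho> \<sigma> P) * lead l \<rho> \<sigma> Q p)
          \<and> vval l \<rho> \<sigma> F = of_int (\<rho> + \<sigma>)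
          \<and> fpoly l \<rho> \<sigma> (wcomm l P F) = fpoly l \<rho> \<sigma> P)"
proof -
  note l = assms(1) and fin = assms(2,3) and QP = assms(6)
  have "\<rho> + \<sigma> > 0" using assms(4) by (simp add: Vset_def)
  then interpret weights l \<rho> \<sigma> using l assms(5) by unfold_locales auto
  have "wcomm l Q P (0, 0) \<noteq> 0" by (simp add: QP wone_def)
  then have "wsupp P \<noteq> {}" "wsupp Q \<noteq> {}" by (auto simp: wcomm_def wmul_def)
  then obtain x y where "P x \<noteq> 0" "Q y \<noteq> 0" unfolding wsupp_def by blast
  obtain u where P: "wle u P" "hat u P \<noteq> 0" using exists_top_weight[OF fin(1) \<open>P x \<noteq> 0\<close>] .
  obtain w where Q: "wle w Q" "hat w Q \<noteq> 0" using exists_top_weight[OF fin(2) \<open>Q y \<noteq> 0\<close>] .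
  note P' = fin(1) P and Q' = fin(2) Q
  have u: "u > 0" and w: "w > 0"
    using assms(7,8) l by (simp_all add: vval_eq[OF P'] vval_eq[OF Q'] zero_less_divide_iff)
  define r where "r = (of_int \<rho> * of_nat l :: 'a)"
  have r: "r \<noteq> 0" using \<rho> l by (simp add: r_def)
  \<comment> \<open>A nonzero value would be, up to the factor \<rho> l, the part of [P, Q] at the
    threshold weight, and \<open>bracket\<close> would be a nonzero leading term.\<close>
  have pq: "pbr (of_int u) (of_int w) (hat u P) (hat w Q) = 0"
  proof (rule ccontr)
    assume "pbr (of_int u) (of_int w) (hat u P) (hat w Q) \<noteq> 0"
    then have nz: "hat (u + w - \<delta>) (wcomm l P Q) \<noteq> 0"
      using wcomm_top(2)[OF fin P(1) Q(1)] by auto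
    then show False
      using assms(9) bracket_eq_lead[OF P' Q' nz] wcomm_top(1)[OF fin P(1) Q(1)]
        lead_neq_0[OF wfin_wcomm[OF fin] _ nz] by simp
  qed
  obtain F where F: "wfin F" "\<forall>x. wt x \<noteq> \<delta> \<longrightarrow> F x = 0"
    and pF: "pbr (of_int u) (of_int \<delta>) (hat u P) (hat \<delta> F) = smult r (hat u P)"
    unfolding r_def using exists_bracket_fixing[OF fin QP P(1) u Q(1) w P(2)] .
  have "hat \<delta> F \<noteq> 0" using pF r P by auto
  moreover have "wle \<delta> F" using F(2) unfolding wle_def by (metis less_irrefl)
  ultimately have F': "wfin F" "wle \<delta> F" "hat \<delta> F \<noteq> 0" using F(1) by auto
  have qF: "pbr (of_int w) (of_int \<delta>) (hat w Q) (hat \<delta> F) = smult r (smult (of_int w / of_int u) (hat w Q))"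
    by (rule pbr_proportional[OF P(2) _ pq pF]) (use u in simp)
  have cancel: "smult r g = smult r h \<Longrightarrow> g = h" for g h using r by (simp add: poly_eq_iff)
  have PF: "hat u (wcomm l P F) = smult 1 (hat u P)" and PF1: "wle u (wcomm l P F)"
    using wcomm_top[OF fin(1) F'(1) P(1) F'(2)] pF by (auto simp: r_def[symmetric] intro: cancel)
  have QF: "hat w (wcomm l Q F) = smult (of_int w / of_int u) (hat w Q)" and QF1: "wle w (wcomm l Q F)"
    using wcomm_top[OF fin(2) F'(1) Q(1) F'(2)] qF by (auto simp: r_def[symmetric] intro: cancel)
  have leadPF: "lead l \<rho> \<sigma> (wcomm l P F) = lead l \<rho> \<sigma> P"
    using lead_eqI[OF P' wfin_wcomm[OF fin(1) F(1)] PF1 PF] by simp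
  have leadQF: "lead l \<rho> \<sigma> (wcomm l Q F) = (\<lambda>x. of_int w / of_int u * lead l \<rho> \<sigma> Q x)"
    by (rule lead_eqI[OF Q' wfin_wcomm[OF fin(2) F(1)] QF1 QF]) (use u w in simp)
  have brP: "bracket l \<rho> \<sigma> P F = lead l \<rho> \<sigma> P"
    using bracket_eq_lead[OF P' F'] PF P leadPF by simp
  have brQ: "bracket l \<rho> \<sigma> Q F = (\<lambda>x. of_int w / of_int u * lead l \<rho> \<sigma> Q x)"
    using bracket_eq_lead[OF Q' F'] QF Q leadQF u w by simp
  have vF: "vval l \<rho> \<sigma> F = of_int (\<rho> + \<sigma>)"
    using l by (simp add: vval_eq[OF F'] \<delta>_def)
  have hF: "homog l \<rho> \<sigma> F"
    unfolding homog_def lead_eq[OF F'] using F(2) by (intro disjI2 ext) (simp del: split_paired_All)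
  have ratio: "of_rat (vval l \<rho> \<sigma> Q / vval l \<rho> \<sigma> P) = (of_int w / of_int u :: 'a)"
    using l by (simp add: vval_eq[OF P'] vval_eq[OF Q'] of_rat_divide)
  have fp: "fpoly l \<rho> \<sigma> (wcomm l P F) = fpoly l \<rho> \<sigma> P"
    by (simp add: fpoly_def leadPF)
  have st: "vdeg l 1 (-1) (st l \<rho> \<sigma> P) \<noteq> 0"
    using vdeg_st_neq_0[OF P' u pF[unfolded r_def]] .
  \<comment> \<open>A leading term supported at one point starts at that point, so this follows from
    the statement on starting points.\<close>
  have "vval l 1 (-1) (lead l \<rho> \<sigma> P) \<noteq> 0" if "(\<rho>, \<sigma>) \<notin> Val l P"
  proof -
    define S where "S = wsupp (lead l \<rho> \<sigma> P)"
    have "S \<subseteq> wsupp P" by (auto simp: S_def wsupp_def lead_def)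
    then have "finite S" using fin(1) by (auto simp: wfin_def intro: finite_subset)
    moreover have "S \<noteq> {}" using lead_neq_0[OF P'] unfolding S_def wsupp_def by blast
    moreover have "card S \<le> 1" using that assms(4) by (simp add: Val_def S_def)
    ultimately have "card S = 1" by (simp add: le_Suc_eq)
    then obtain x where x: "S = {x}" by (auto simp: card_1_singleton_iff)
    then have "st l \<rho> \<sigma> P = x"
      unfolding st_def S_def[symmetric] Let_def by (intro the_equality) auto
    then show ?thesis using st x by (simp add: vval_def S_def)
  qed
  then show ?thesis using st F(1) hF brP brQ vF fp ratio by auto
qed

end
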